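(* Let $\mathcal T$ be a regular linear tessellation with activities $\pi_l\in(0,1)$, $k\ge2$ the number of colours, $\alpha_V\in[0,1]$, and let $\hat{\mathcal A}_\Phi$ be the whole-plane consistent polygonal field. Let $l$ be a straight line in $\mathbb R^2$ that contains no nodes of $\mathcal T$. Then the intersection points and intersection directions of $l$ with the edges of $\hat{\mathcal A}_\Phi$ coincide in distribution with the intersection points and directions of $l$ with the line field $\Lambda_{\mathcal T}$, defined to be the random sub-collection of $\mathcal T$ in which each line $l^*\in\mathcal T$ is chosen to belong to $\Lambda_{\mathcal T}$ with probability $\pi_{l^*}/(1+\pi_{l^*})$ and rejected otherwise, all these choices being made independently.
   Context: Regular linear tessellation: a countable family $\mathcal T$ of straight lines in $\mathbb R^2$ such that no three lines of $\mathcal T$ meet at one point and every bounded set is hit by finitely many lines of $\mathcal T$. Each $l\in\mathcal T$ carries a fixed activity $\pi_l\in(0,1)$. Windows: bounded open convex sets $D\subseteq\mathbb R^2$ such that $\partial D$ contains no intersection point of two lines of $\mathcal T$ and every line of $\mathcal T$ hitting $\overline D$ meets $\partial D$ in exactly two points. $\mathcal T$ partitions $D$ into finitely many convex cells. Nodes are the intersection points $n(l_1,l_2)$ of two lines of $\mathcal T$; segments are the pieces of lines of $\mathcal T$ between consecutive nodes (possibly truncated by $\partial D$). Admissible configurations: assigning each cell a colour in $\{1,\dots,k\}$ gives a coloured planar graph $\hat\gamma$ in $\overline D$, whose underlying uncoloured graph $\gamma$ consists of all segments separating cells of different colours. The set $\hat\Gamma_D(\mathcal T)$ of admissible coloured polygonal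 configurations is the set of all coloured planar graphs with edges on lines of $\mathcal T$, interior vertices (in $D$) of degree 2, 3 or 4, boundary vertices (on $\partial D$) of degree 1, and no two adjacent faces (faces sharing an edge) of the same colour. It is in bijection with the colourings of the cells. A node lying inside a straight piece of $\gamma$ at which no other segment of $\gamma$ ends or passes is not a vertex. V-, T- and X-vertices are the interior vertices of degree 2, 3 and 4, and $N_V(\gamma),N_T(\gamma),N_X(\gamma)$ are their numbers. $E(\gamma)$ is the set of edges: maximal unions of connected collinear segments of $\gamma$ not broken by a vertex; edges are taken open. $E^*(\gamma)$ is the set of primary edges: maximal unions of connected collinear segments of $\gamma$ (possibly containing several edges because of T- or X-vertices). $l[e]$ is the line of $\mathcal T$ containing $e$. Consistent polygonal field: given $\alpha_V\in[0,1]$ put $\alpha_X=1-\alpha_V$, $\alpha_T=\frac12\bigl(1-\frac{k-2}{k-1}\alpha_X\bigr)$, $\epsilon=\frac{\alpha_V}{k-1}+\frac{k-2}{k-1}\alpha_T$, and $$\Phi_D(\hat\gamma)=-N_V(\gamma)\log\alpha_V-N_T(\gamma)\log((k-1)\alpha_T)-N_X(\gamma)\log((k-1)\alpha_X)+\mathrm{card}(E(\gamma))\log(k-1)$$ $$-\sum_{e\in E(\gamma)}\ \sum_{l\in\mathcal T,\,l\nsim e}\log(1-\epsilon\pi_l)+\sum_{n(l_1,l_2)\in\gamma}\log\Bigl(1-\frac{\alpha_V}{k-1}\pi_{l_1}\pi_{l_2}\Bigr),$$ with $0\times\infty=0$. Here $l\nsim e$ means that $l$ intersects the open edge $e$ but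 is not collinear with it, and $n(l_1,l_2)\in\gamma$ ranges over nodes lying on edges of $\gamma$ or coinciding with vertices of $\gamma$. The consistent polygonal field $\hat{\mathcal A}_{\Phi_D}$ is the random element of $\hat\Gamma_D(\mathcal T)$ with $\mathbb P(\hat{\mathcal A}_{\Phi_D}=\hat\gamma)\propto e^{-\Phi_D(\hat\gamma)}\prod_{e\in E^*(\gamma)}\pi_{l[e]}$. Whole-plane field: the fields $\hat{\mathcal A}_{\Phi_D}$ are consistent, i.e. for windows $D'\subseteq D$ the restriction $\hat{\mathcal A}_{\Phi_D}\cap D'$ has the law of $\hat{\mathcal A}_{\Phi_{D'}}$; by Kolmogorov's theorem there is a random coloured configuration $\hat{\mathcal A}_\Phi$ on $\mathbb R^2$ (with edges on lines of $\mathcal T$), unique in law, such that $\hat{\mathcal A}_\Phi\cap D$ has the law of $\hat{\mathcal A}_{\Phi_D}$ for every window $D$. *)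

theory Defs
  imports "HOL-Probability.Probability"
begin

type_synonym plane = "real ^ 2"

section \<open>Tessellations and windows\<close>

definition straight_line :: "plane set \<Rightarrow> bool" where
  "straight_line L \<longleftrightarrow> affine L \<and> aff_dim L = 1"

definition regular_tessellation :: "plane set set \<Rightarrow> bool" where
  "regular_tessellation T \<longleftrightarrow>
     countable T \<and> (\<forall>L\<in>T. straight_line L) \<and>
     (\<forall>L1\<in>T. \<forall>L2\<in>T. \<forall>L3\<in>T. L1 \<noteq> L2 \<and> L1 \<noteq> L3 \<and> L2 \<noteq> L3 \<longrightarrow> L1 \<inter> L2 \<inter> L3 = {}) \<and>
     (\<forall>B. bounded B \<longrightarrow> finite {L \<in> T. L \<inter> B \<noteq> {}})"

definition nodes :: "plane set set \<Rightarrow> plane set" where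
  "nodes T = {p. \<exists>L1\<in>T. \<exists>L2\<in>T. L1 \<noteq> L2 \<and> p \<in> L1 \<inter> L2}"

definition window :: "plane set set \<Rightarrow> plane set \<Rightarrow> bool" where
  "window T D \<longleftrightarrow>
     bounded D \<and> open D \<and> convex D \<and> frontier D \<inter> nodes T = {} \<and>
     (\<forall>L\<in>T. L \<inter> closure D \<noteq> {} \<longrightarrow> card (L \<inter> frontier D) = 2)"

section \<open>Planar graphs with edges on the lines of a tessellation\<close>

text \<open>
  Everything below is parametrised by an open convex region \<open>D\<close>, which is either a window
  or the whole plane \<open>UNIV\<close>. A graph is represented by the closed subset \<open>\<gamma>\<close> of
  \<open>closure D\<close> that it occupies. Segments are taken relatively open.
\<close>

definition segments :: "plane set set \<Rightarrow> plane set \<Rightarrow> plane set set" where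
  "segments T D = (\<Union>L\<in>T. components (L \<inter> D - nodes T))"

definition is_graph :: "plane set set \<Rightarrow> plane set \<Rightarrow> plane set \<Rightarrow> bool" where
  "is_graph T D \<gamma> \<longleftrightarrow> (\<exists>S\<subseteq>segments T D. \<gamma> = \<Union>(closure ` S))"

definition graph_segments :: "plane set set \<Rightarrow> plane set \<Rightarrow> plane set \<Rightarrow> plane set set" where
  "graph_segments T D \<gamma> = {s \<in> segments T D. s \<subseteq> \<gamma>}"

definition segments_at :: "plane set set \<Rightarrow> plane set \<Rightarrow> plane set \<Rightarrow> plane \<Rightarrow> plane set set" where
  "segments_at T D \<gamma> p = {s \<in> graph_segments T D \<gamma>. p \<in> closure s}"

definition degree_at :: "plane set set \<Rightarrow> plane set \<Rightarrow> plane set \<Rightarrow> plane \<Rightarrow> nat" where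
  "degree_at T D \<gamma> p = card (segments_at T D \<gamma> p)"

text \<open>The graph goes straight through \<open>p\<close>, along a single line, and nothing else happens at \<open>p\<close>.\<close>

definition passes_straight :: "plane set set \<Rightarrow> plane set \<Rightarrow> plane set \<Rightarrow> plane \<Rightarrow> bool" where
  "passes_straight T D \<gamma> p \<longleftrightarrow>
     degree_at T D \<gamma> p = 2 \<and> (\<exists>L\<in>T. \<forall>s\<in>segments_at T D \<gamma> p. s \<subseteq> L)"

definition interior_vertices :: "plane set set \<Rightarrow> plane set \<Rightarrow> plane set \<Rightarrow> plane set" where
  "interior_vertices T D \<gamma> = {p \<in> nodes T \<inter> D \<inter> \<gamma>. \<not> passes_straight T D \<gamma> p}"

definition boundary_vertices :: "plane set \<Rightarrow> plane set \<Rightarrow> plane set" where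
  "boundary_vertices D \<gamma> = \<gamma> \<inter> frontier D"

definition vertices_of_degree ::
  "plane set set \<Rightarrow> plane set \<Rightarrow> plane set \<Rightarrow> nat \<Rightarrow> plane set" where
  "vertices_of_degree T D \<gamma> d = {p \<in> interior_vertices T D \<gamma>. degree_at T D \<gamma> p = d}"

definition N_V :: "plane set set \<Rightarrow> plane set \<Rightarrow> plane set \<Rightarrow> nat" where
  "N_V T D \<gamma> = card (vertices_of_degree T D \<gamma> 2)"

definition N_T :: "plane set set \<Rightarrow> plane set \<Rightarrow> plane set \<Rightarrow> nat" where
  "N_T T D \<gamma> = card (vertices_of_degree T D \<gamma> 3)"

definition N_X :: "plane set set \<Rightarrow> plane set \<Rightarrow> plane set \<Rightarrow> nat" where
  "N_X T D \<gamma> = card (vertices_of_degree T D \<gamma> 4)"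

text \<open>
  The part of the graph that runs along the line \<open>L\<close>. This is in general smaller than \<open>\<gamma> \<inter> L\<close>,
  which also contains the nodes at which \<open>\<gamma>\<close> merely crosses \<open>L\<close>.
\<close>

definition line_part :: "plane set set \<Rightarrow> plane set \<Rightarrow> plane set \<Rightarrow> plane set \<Rightarrow> plane set" where
  "line_part T D \<gamma> L = \<Union>(closure ` {s \<in> graph_segments T D \<gamma>. s \<subseteq> L})"

definition edges :: "plane set set \<Rightarrow> plane set \<Rightarrow> plane set \<Rightarrow> plane set set" where
  "edges T D \<gamma> = (\<Union>L\<in>T. components (line_part T D \<gamma> L \<inter> D - interior_vertices T D \<gamma>))"

definition primary_edges :: "plane set set \<Rightarrow> plane set \<Rightarrow> plane set \<Rightarrow> plane set set" where
  "primary_edges T D \<gamma> = (\<Union>L\<in>T. components (line_part T D \<gamma> L))"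

definition line_of :: "plane set set \<Rightarrow> plane set \<Rightarrow> plane set" where
  "line_of T e = (THE L. L \<in> T \<and> e \<subseteq> L)"

definition crossing_lines :: "plane set set \<Rightarrow> plane set \<Rightarrow> plane set set" where
  "crossing_lines T e = {L \<in> T. L \<inter> e \<noteq> {} \<and> \<not> e \<subseteq> L}"

definition graph_nodes :: "plane set set \<Rightarrow> plane set \<Rightarrow> plane set \<Rightarrow> plane set" where
  "graph_nodes T D \<gamma> =
     nodes T \<inter> (\<Union>(edges T D \<gamma>) \<union> interior_vertices T D \<gamma> \<union> boundary_vertices D \<gamma>)"

section \<open>Coloured configurations\<close>

definition faces :: "plane set \<Rightarrow> plane set \<Rightarrow> plane set set" where
  "faces D \<gamma> = components (D - \<gamma>)"

definition share_edge ::
  "plane set set \<Rightarrow> plane set \<Rightarrow> plane set \<Rightarrow> plane set \<Rightarrow> plane set \<Rightarrow> bool" where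
  "share_edge T D \<gamma> F G \<longleftrightarrow> (\<exists>e\<in>edges T D \<gamma>. e \<subseteq> frontier F \<inter> frontier G)"

text \<open>
  A coloured graph is a pair of a graph and a colouring of its faces. The colouring is given as
  a function on points, constant on each face; the dummy value 0 off the faces makes the
  representation unique. Every edge has to lie between two different faces: an edge with the same
  face on both sides would make that face adjacent to itself.
\<close>

type_synonym configuration = "plane set \<times> (plane \<Rightarrow> nat)"

definition configurations :: "plane set set \<Rightarrow> nat \<Rightarrow> plane set \<Rightarrow> configuration set" where
  "configurations T k D = {(\<gamma>, c).
     is_graph T D \<gamma> \<and>
     (\<forall>p\<in>interior_vertices T D \<gamma>. degree_at T D \<gamma> p \<in> {2, 3, 4}) \<and>
     (\<forall>p\<in>boundary_vertices D \<gamma>. degree_at T D \<gamma> p = 1) \<and>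
     (\<forall>x. if x \<in> D - \<gamma> then c x \<in> {1..k} else c x = 0) \<and>
     (\<forall>F\<in>faces D \<gamma>. c constant_on F) \<and>
     (\<forall>e\<in>edges T D \<gamma>. \<exists>F\<in>faces D \<gamma>. \<exists>G\<in>faces D \<gamma>. F \<noteq> G \<and> e \<subseteq> frontier F \<inter> frontier G) \<and>
     (\<forall>F\<in>faces D \<gamma>. \<forall>G\<in>faces D \<gamma>. F \<noteq> G \<and> share_edge T D \<gamma> F G \<longrightarrow>
        (\<forall>x\<in>F. \<forall>y\<in>G. c x \<noteq> c y))}"

definition restrict_config :: "plane set \<Rightarrow> configuration \<Rightarrow> configuration" where
  "restrict_config D = (\<lambda>(\<gamma>, c). (\<gamma> \<inter> closure D, \<lambda>x. if x \<in> D then c x else 0))"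

section \<open>Consistent polygonal fields\<close>

text \<open>
  Logarithm and exponential with \<open>log 0 = -\<infinity>\<close> and \<open>exp (-\<infinity>) = 0\<close>; the convention
  \<open>0 * \<infinity> = 0\<close> is that of the type \<open>ereal\<close>. The energy is never \<open>-\<infinity>\<close>, and no
  sum \<open>\<infinity> - \<infinity>\<close> occurs in it.
\<close>

definition elog :: "real \<Rightarrow> ereal" where
  "elog x = (if x = 0 then -\<infinity> else ereal (ln x))"

definition eexp :: "ereal \<Rightarrow> ennreal" where
  "eexp x = (if x = \<infinity> then \<infinity> else if x = -\<infinity> then 0 else ennreal (exp (real_of_ereal x)))"

definition alpha_X :: "real \<Rightarrow> real" where
  "alpha_X \<alpha>\<^sub>V = 1 - \<alpha>\<^sub>V"

definition alpha_T :: "nat \<Rightarrow> real \<Rightarrow> real" where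
  "alpha_T k \<alpha>\<^sub>V = 1 / 2 * (1 - (real k - 2) / (real k - 1) * alpha_X \<alpha>\<^sub>V)"

definition epsilon :: "nat \<Rightarrow> real \<Rightarrow> real" where
  "epsilon k \<alpha>\<^sub>V = \<alpha>\<^sub>V / (real k - 1) + (real k - 2) / (real k - 1) * alpha_T k \<alpha>\<^sub>V"

text \<open>Every node lies on exactly two lines \<open>L1\<close>, \<open>L2\<close>, so the product in the last sum is \<open>\<pi> L1 * \<pi> L2\<close>.\<close>

definition energy ::
  "plane set set \<Rightarrow> (plane set \<Rightarrow> real) \<Rightarrow> nat \<Rightarrow> real \<Rightarrow> plane set \<Rightarrow> configuration \<Rightarrow> ereal" where
  "energy T \<pi> k \<alpha>\<^sub>V D = (\<lambda>(\<gamma>, c).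
     - (ereal (real (N_V T D \<gamma>)) * elog \<alpha>\<^sub>V)
     - ereal (real (N_T T D \<gamma>)) * elog ((real k - 1) * alpha_T k \<alpha>\<^sub>V)
     - ereal (real (N_X T D \<gamma>)) * elog ((real k - 1) * alpha_X \<alpha>\<^sub>V)
     + ereal (real (card (edges T D \<gamma>))) * elog (real k - 1)
     - (\<Sum>e\<in>edges T D \<gamma>. \<Sum>L\<in>crossing_lines T e. elog (1 - epsilon k \<alpha>\<^sub>V * \<pi> L))
     + (\<Sum>p\<in>graph_nodes T D \<gamma>.
          elog (1 - \<alpha>\<^sub>V / (real k - 1) * (\<Prod>L\<in>{L \<in> T. p \<in> L}. \<pi> L))))"

definition config_weight ::
  "plane set set \<Rightarrow> (plane set \<Rightarrow> real) \<Rightarrow> nat \<Rightarrow> real \<Rightarrow> plane set \<Rightarrow> configuration \<Rightarrow> ennreal" where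
  "config_weight T \<pi> k \<alpha>\<^sub>V D \<gamma>c =
     eexp (- energy T \<pi> k \<alpha>\<^sub>V D \<gamma>c) *
     ennreal (\<Prod>e\<in>primary_edges T D (fst \<gamma>c). \<pi> (line_of T e))"

definition consistent_field_law ::
  "plane set set \<Rightarrow> (plane set \<Rightarrow> real) \<Rightarrow> nat \<Rightarrow> real \<Rightarrow> plane set \<Rightarrow> configuration measure" where
  "consistent_field_law T \<pi> k \<alpha>\<^sub>V D =
     point_measure (configurations T k D)
       (\<lambda>\<gamma>c. config_weight T \<pi> k \<alpha>\<^sub>V D \<gamma>c / (\<Sum>\<gamma>c'\<in>configurations T k D. config_weight T \<pi> k \<alpha>\<^sub>V D \<gamma>c'))"

definition whole_plane_field ::
  "plane set set \<Rightarrow> (plane set \<Rightarrow> real) \<Rightarrow> nat \<Rightarrow> real \<Rightarrow> 'w measure \<Rightarrow> ('w \<Rightarrow> configuration) \<Rightarrow> bool" where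
  "whole_plane_field T \<pi> k \<alpha>\<^sub>V M A \<longleftrightarrow>
     prob_space M \<and> (\<forall>\<omega>\<in>space M. A \<omega> \<in> configurations T k UNIV) \<and>
     (\<forall>D. window T D \<longrightarrow>
        (\<lambda>\<omega>. restrict_config D (A \<omega>)) \<in> measurable M (count_space (configurations T k D)) \<and>
        distr M (count_space (configurations T k D)) (\<lambda>\<omega>. restrict_config D (A \<omega>))
          = consistent_field_law T \<pi> k \<alpha>\<^sub>V D)"

section \<open>The line field\<close>

text \<open>Independent coin flips, one for each line, and the random collection of lines they select.\<close>

definition line_flips :: "plane set set \<Rightarrow> (plane set \<Rightarrow> real) \<Rightarrow> (plane set \<Rightarrow> bool) measure" where
  "line_flips T \<pi> = PiM T (\<lambda>L. measure_pmf (bernoulli_pmf (\<pi> L / (1 + \<pi> L))))"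

definition line_field :: "plane set set \<Rightarrow> (plane set \<Rightarrow> bool) \<Rightarrow> plane set set" where
  "line_field T \<omega> = {L \<in> T. \<omega> L}"

section \<open>Intersections with a line\<close>

text \<open>The direction of a straight piece \<open>e\<close> is recorded by its angle in \<open>[0, \<pi>)\<close> with the first axis.\<close>

definition has_direction :: "plane set \<Rightarrow> real \<Rightarrow> bool" where
  "has_direction e \<theta> \<longleftrightarrow>
     0 \<le> \<theta> \<and> \<theta> < pi \<and> (\<forall>x\<in>e. \<forall>y\<in>e. \<exists>t. y - x = t *\<^sub>R vector [cos \<theta>, sin \<theta>])"

definition intersections :: "plane set \<Rightarrow> plane set set \<Rightarrow> (plane \<times> real) set" where
  "intersections l E = {(p, \<theta>). \<exists>e\<in>E. p \<in> l \<inter> e \<and> has_direction e \<theta>}"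

text \<open>
  Point patterns with the usual sigma-algebra of point process theory, which is generated by the
  numbers of points in Borel sets.
\<close>

definition point_patterns :: "'a :: topological_space set measure" where
  "point_patterns =
     sigma UNIV {{S. emeasure (count_space UNIV) (S \<inter> B) \<in> C} | B C. B \<in> sets borel \<and> C \<in> sets borel}"

end

theory Submission
  imports Defs
begin

text \<open>
  Take finitely many lines of \<open>T\<close> that meet \<open>l\<close>. A sufficiently thin window around a piece of \<open>l\<close>
  contains no nodes, and its cells form a chain separated by disjoint chords. A configuration in it is
  a set \<open>S\<close> of chords together with a proper colouring of a path with \<open>card S + 1\<close> vertices. There are
  \<open>k * (k - 1) ^ card S\<close> such colourings, each of weight \<open>(\<Prod>L\<in>S. \<pi> L) / (k - 1) ^ card S\<close>, so the chords are present independently with probabilities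
  \<open>\<pi> L / (1 + \<pi> L)\<close>. By uniqueness of product measures this determines the joint law of all the
  indicators that the edges of the field cross \<open>l\<close> along \<open>L\<close>, and the pattern on \<open>l\<close> is a measurable
  function of these indicators.
\<close>

section \<open>Lines and thin windows\<close>

text \<open>The interaction acts wherever lines of \<open>T\<close> cross, so the law becomes
  explicit only in windows whose closure avoids the nodes. As \<open>l\<close> contains no nodes and
  \<open>T\<close> is locally finite, a compact piece of \<open>l\<close> keeps a positive distance
  from all nodes, and a small neighbourhood of it is such a window. There every term of the energy
  except the edge count vanishes. The obstacle is that the edges of the whole-plane graph and those
  of its restriction to a window are different sets. Both are reduced to one datum: whether a chosen
  point \<open>q L\<close> of \<open>L \<inter> l\<close> lies in the graph. Membership of a point
  survives restriction. Since \<open>L \<inter> l\<close> is connected and free of nodes, it lies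
  inside one segment of \<open>L\<close>, so this point decides about the whole intersection, also
  when \<open>l \<in> T\<close>. A window sees finitely many lines while \<open>l\<close> may meet
  infinitely many, hence the detour through finite marginals.\<close>

lemma straight_line_eq_affine_hull:
  assumes "straight_line L" "p \<in> L" "q \<in> L" "p \<noteq> q"
  shows "L = affine hull {p, q}"
proof (rule affine_dim_equal[symmetric])
  show "affine hull {p, q} \<subseteq> L"
    using assms by (simp add: hull_minimal straight_line_def)
  show "aff_dim (affine hull {p, q}) = aff_dim L"
    using assms by (simp add: aff_dim_2 straight_line_def)
qed (use assms in \<open>auto simp: straight_line_def affine_affine_hull\<close>)

lemma straight_line_parametrization:
  assumes "straight_line L" "p \<in> L"
  obtains v where "v \<noteq> 0" "L = range (\<lambda>t. p + t *\<^sub>R v)"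
proof -
  have "L \<noteq> {p}"
    using assms(1) by (auto simp: straight_line_def)
  then obtain q where q: "q \<in> L" "p \<noteq> q" using assms(2) by blast
  have "L = range (\<lambda>t. p + t *\<^sub>R (q - p))"
    using straight_line_eq_affine_hull[OF assms q] unfolding affine_hull_2_alt .
  moreover have "q - p \<noteq> 0" using q by simp
  ultimately show ?thesis by (rule that[rotated])
qed

text \<open>In the plane, dimension 1 is codimension 1, so a line is a hyperplane.\<close>

lemma straight_line_normal:
  assumes "straight_line L" "p \<in> L"
  obtains n where "n \<noteq> 0" "L = {x. n \<bullet> (x - p) = 0}"
proof -
  have "aff_dim L = int (DIM(plane) - 1)" and hull: "affine hull L = L"
    using assms by (auto simp: straight_line_def affine_hull_eq)
  then obtain n b where "n \<noteq> 0" "L = {x. n \<bullet> x = b}"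
    unfolding aff_dim_eq_hyperplane hull by auto
  moreover then have "L = {x. n \<bullet> (x - p) = 0}"
    using assms(2) by (auto simp: inner_diff_right)
  ultimately show ?thesis by (intro that)
qed

lemma straight_line_closed: "straight_line L \<Longrightarrow> closed L"
  by (simp add: affine_closed straight_line_def)

lemma straight_line_convex: "straight_line L \<Longrightarrow> convex L"
  by (simp add: affine_imp_convex straight_line_def)

lemma unique_line_through_non_node:
  assumes "L \<in> T" "L' \<in> T" "x \<in> L" "x \<in> L'" "x \<notin> nodes T"
  shows "L = L'"
  using assms by (auto simp: nodes_def)

text \<open>Each of the two rays of \<open>L\<close> from the interior point \<open>p\<close> leaves
  \<open>D\<close> once and never touches the closure again. This yields the last clause of
  \<open>window\<close> for lines that meet \<open>D\<close> itself.\<close>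

lemma card_line_Int_frontier:
  fixes D :: "plane set"
  assumes D: "bounded D" "open D" "convex D" and L: "straight_line L" "p \<in> L" "p \<in> D"
  shows "card (L \<inter> frontier D) = 2"
proof -
  obtain v where v: "v \<noteq> 0" "L = range (\<lambda>t. p + t *\<^sub>R v)"
    using straight_line_parametrization[OF L(1,2)] .
  have pD: "p \<in> interior D" using L D by (simp add: interior_open)
  obtain s where s: "0 < s" "p + s *\<^sub>R v \<in> frontier D" "\<And>e. 0 \<le> e \<Longrightarrow> e < s \<Longrightarrow> p + e *\<^sub>R v \<in> interior D"
    using ray_to_frontier[OF D(1) pD v(1)] by blast
  obtain r where r: "0 < r" "p + r *\<^sub>R (- v) \<in> frontier D" "\<And>e. 0 \<le> e \<Longrightarrow> e < r \<Longrightarrow> p + e *\<^sub>R (-v) \<in> interior D"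
    using ray_to_frontier[OF D(1) pD, of "-v"] v(1) by (metis neg_equal_0_iff_equal)
  \<comment> \<open>A point of the closure beyond the exit point could be shrunk towards the
    interior point \<open>p\<close>, which would make the exit point interior.\<close>
  have beyond: "w \<notin> closure D" if "0 < u" "u < e" "p + u *\<^sub>R d \<in> frontier D" "w = p + e *\<^sub>R d" for u e w d
  proof
    assume w: "w \<in> closure D"
    have "(1 - u / e) * e = e - u"
      using that by (simp add: left_diff_distrib)
    then have "p + u *\<^sub>R d = w - (1 - u / e) *\<^sub>R (w - p)"
      using that by (simp add: scaleR_left_diff_distrib)
    then have "p + u *\<^sub>R d \<in> interior D"
      using mem_interior_closure_convex_shrink[OF D(3) pD w, of "1 - u/e"] that(1,2) by simp
    then show False using that by (simp add: frontier_def)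
  qed
  have "L \<inter> frontier D = {p + s *\<^sub>R v, p + r *\<^sub>R (- v)}"
  proof
    show "L \<inter> frontier D \<subseteq> {p + s *\<^sub>R v, p + r *\<^sub>R (- v)}"
    proof
      fix x assume x: "x \<in> L \<inter> frontier D"
      then obtain t where t: "x = p + t *\<^sub>R v" using v by auto
      have xc: "x \<in> closure D" "x \<notin> interior D" using x by (auto simp: frontier_def)
      show "x \<in> {p + s *\<^sub>R v, p + r *\<^sub>R (- v)}"
      proof (cases "0 \<le> t")
        case True
        then have "\<not> t < s" "\<not> s < t" using s(3)[of t] beyond[OF s(1) _ s(2), of t x] xc t by auto
        then show ?thesis using t by auto
      next
        case False
        have t': "x = p + (-t) *\<^sub>R (-v)" using t by simp
        then have "\<not> -t < r" "\<not> r < -t" using False r(3)[of "-t"] beyond[OF r(1) _ r(2), of "-t" x] xc t' by auto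
        then show ?thesis using t' by auto
      qed
    qed
    show "{p + s *\<^sub>R v, p + r *\<^sub>R (- v)} \<subseteq> L \<inter> frontier D"
    proof -
      have "p + r *\<^sub>R (- v) = p + (- r) *\<^sub>R v" by simp
      then have "p + r *\<^sub>R (- v) \<in> L" "p + s *\<^sub>R v \<in> L" unfolding v(2) by blast+
      then show ?thesis using s(2) r(2) by blast
    qed
  qed
  moreover have "p + s *\<^sub>R v \<noteq> p + r *\<^sub>R (- v)"
  proof
    assume "p + s *\<^sub>R v = p + r *\<^sub>R (- v)"
    then have "(s + r) *\<^sub>R v = 0" by (simp add: algebra_simps)
    then show False using v(1) s(1) r(1) by simp
  qed
  ultimately show ?thesis by simp
qed

text \<open>The window is the Minkowski sum of \<open>K\<close> and a small ball, hence open,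
  bounded and convex. That lines hitting \<open>closure D\<close> already hit \<open>K\<close> rules
  out lines that merely touch the frontier.\<close>

lemma exists_thin_window:
  assumes T: "regular_tessellation T"
    and K: "compact K" "convex K" "K \<noteq> {}" "K \<inter> nodes T = {}"
  shows "\<exists>D. window T D \<and> K \<subseteq> D \<and> closure D \<inter> nodes T = {} \<and>
    (\<forall>L\<in>T. L \<inter> closure D \<noteq> {} \<longrightarrow> L \<inter> K \<noteq> {})"
proof -
  define U where "U = (\<Union>x\<in>K. \<Union>y\<in>cball (0::plane) 1. {x + y})"
  define TU where "TU = {L \<in> T. L \<inter> U \<noteq> {}}"
  \<comment> \<open>Everything the closed window has to avoid: lines missing \<open>K\<close>, and
    crossing points. Only the finitely many lines within distance 1 of \<open>K\<close> matter, so
    \<open>C\<close> is closed and has a positive distance from \<open>K\<close>.\<close>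
  define C where "C = \<Union>{L \<in> TU. L \<inter> K = {}} \<union> \<Union>((\<lambda>(L, L'). L \<inter> L') ` {(L, L') \<in> TU \<times> TU. L \<noteq> L'})"
  have cU: "compact U" unfolding U_def by (rule compact_sums'[OF K(1) compact_cball])
  have fin: "finite TU"
    using T compact_imp_bounded[OF cU] unfolding regular_tessellation_def TU_def by blast
  have sl: "straight_line L" if "L \<in> T" for L using T that by (auto simp: regular_tessellation_def)
  have "closed C"
    unfolding C_def
  proof (intro closed_Un closed_Union ballI)
    show "finite ((\<lambda>(L, L'). L \<inter> L') ` {(L, L') \<in> TU \<times> TU. L \<noteq> L'})"
      by (rule finite_imageI, rule finite_subset[of _ "TU \<times> TU"]) (use fin in auto)
    show "finite {L \<in> TU. L \<inter> K = {}}" using fin by simp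
  qed (use sl straight_line_closed in \<open>auto simp: TU_def\<close>)
  moreover have "K \<inter> C = {}"
  proof -
    have False if x: "x \<in> K" "L \<in> TU" "L' \<in> TU" "L \<noteq> L'" "x \<in> L" "x \<in> L'" for x L L'
      using x K(4) by (auto simp: nodes_def TU_def)
    then show ?thesis unfolding C_def by auto
  qed
  ultimately obtain d where d: "0 < d" "\<And>x y. x \<in> K \<Longrightarrow> y \<in> C \<Longrightarrow> d \<le> dist x y"
    using separate_compact_closed[OF K(1), of C] by metis
  \<comment> \<open>Half of \<open>d\<close> keeps even the closed \<open>r\<close>-neighbourhood
    away from \<open>C\<close>; the bound 1 keeps it inside \<open>U\<close>.\<close>
  define r where "r = min (d / 2) 1"
  have r: "0 < r" "r < d" "r \<le> 1" using d by (auto simp: r_def)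
  define D where "D = (\<Union>x\<in>K. \<Union>y\<in>ball (0::plane) r. {x + y})"
  have cl: "\<exists>x\<in>K. \<exists>y\<in>cball 0 r. z = x + y" if "z \<in> closure D" for z
  proof -
    have "closure D \<subseteq> (\<Union>x\<in>K. \<Union>y\<in>cball (0::plane) r. {x + y})"
    proof (rule closure_minimal)
      show "closed (\<Union>x\<in>K. \<Union>y\<in>cball (0::plane) r. {x + y})"
        by (intro compact_imp_closed compact_sums' K compact_cball)
      show "D \<subseteq> (\<Union>x\<in>K. \<Union>y\<in>cball (0::plane) r. {x + y})"
        unfolding D_def by (intro UN_mono order_refl ball_subset_cball)
    qed
    then show ?thesis using that by blast
  qed
  have clU: "closure D \<subseteq> U"
  proof
    fix z assume "z \<in> closure D"
    then obtain x y where "x \<in> K" "y \<in> cball 0 r" "z = x + y" using cl by blast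
    moreover then have "y \<in> cball 0 1" using r by simp
    ultimately show "z \<in> U" unfolding U_def by blast
  qed
  have clC: "closure D \<inter> C = {}"
  proof -
    have False if z: "z \<in> closure D" "z \<in> C" for z
    proof -
      obtain x y where xy: "x \<in> K" "y \<in> cball 0 r" "z = x + y" using cl z by blast
      have "d \<le> norm y" using d(2)[OF xy(1) z(2)] xy(3) by (simp add: dist_norm)
      then show False using xy(2) r by simp
    qed
    then show ?thesis by blast
  qed
  have nod: "closure D \<inter> nodes T = {}"
  proof -
    have False if x: "x \<in> closure D" "L1 \<in> T" "L2 \<in> T" "L1 \<noteq> L2" "x \<in> L1 \<inter> L2" for x L1 L2
    proof -
      have "L1 \<in> TU" "L2 \<in> TU" using x clU by (auto simp: TU_def)
      then have "x \<in> C" using x unfolding C_def by blast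
      then show False using x clC by blast
    qed
    then show ?thesis by (auto simp: nodes_def)
  qed
  have hit: "L \<inter> K \<noteq> {}" if L: "L \<in> T" "L \<inter> closure D \<noteq> {}" for L
  proof
    assume "L \<inter> K = {}"
    moreover have "L \<in> TU" using L clU by (auto simp: TU_def)
    ultimately have "L \<subseteq> C" unfolding C_def by blast
    then show False using L clC by blast
  qed
  have KD: "K \<subseteq> D"
  proof
    fix x assume "x \<in> K"
    moreover have "x = x + 0" "0 \<in> ball (0::plane) r" using r by simp_all
    ultimately show "x \<in> D" unfolding D_def by blast
  qed
  have D: "bounded D" "open D" "convex D"
    unfolding D_def
    by (rule bounded_sums[OF compact_imp_bounded[OF K(1)] bounded_ball])
      (rule open_sums[OF disjI2[OF open_ball]], rule convex_sums[OF K(2) convex_ball])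
  have "window T D"
    unfolding window_def
  proof (intro conjI ballI impI D)
    show "frontier D \<inter> nodes T = {}" using nod by (auto simp: frontier_def)
    fix L assume L: "L \<in> T" "L \<inter> closure D \<noteq> {}"
    then obtain p where "p \<in> L" "p \<in> D" using hit KD by blast
    then show "card (L \<inter> frontier D) = 2"
      using card_line_Int_frontier[OF D sl[OF L(1)]] by blast
  qed
  then show ?thesis using KD nod hit by (intro exI[of _ D] conjI ballI impI)
qed

section \<open>Chains of cells\<close>

text \<open>
  A convex region without nodes is crossed by the lines of \<open>T\<close> in disjoint chords, the rungs. All of
  them meet the transversal \<open>b + \<real> v\<close> inside \<open>D\<close>, so that \<open>t\<close> orders the rungs and the cells
  form a chain. The normals point upwards along the transversal.
\<close>

locale ladder =
  fixes T :: "plane set set" and D :: "plane set" and n :: "plane set \<Rightarrow> plane"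
    and b v :: plane and t :: "plane set \<Rightarrow> real"
  assumes open_D: "open D" and convex_D: "convex D" and ne_D: "D \<noteq> {}"
    and no_nodes: "closure D \<inter> nodes T = {}"
    and lines: "\<And>L. L \<in> T \<Longrightarrow> straight_line L"
    and finite_rungs: "finite {L \<in> T. L \<inter> D \<noteq> {}}"
    and rung_eq: "\<And>L. L \<in> T \<Longrightarrow> L \<inter> D \<noteq> {} \<Longrightarrow> L = {x. n L \<bullet> (x - (b + t L *\<^sub>R v)) = 0}"
    and rung_in_D: "\<And>L. L \<in> T \<Longrightarrow> L \<inter> D \<noteq> {} \<Longrightarrow> b + t L *\<^sub>R v \<in> D"
    and normal_pos: "\<And>L. L \<in> T \<Longrightarrow> L \<inter> D \<noteq> {} \<Longrightarrow> n L \<bullet> v > 0"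
begin

definition rungs :: "plane set set" where
  "rungs = {L \<in> T. L \<inter> D \<noteq> {}}"

definition p :: "plane set \<Rightarrow> plane" where
  "p L = b + t L *\<^sub>R v"

definition f :: "plane set \<Rightarrow> plane \<Rightarrow> real" where
  "f L x = n L \<bullet> (x - p L)"

text \<open>These are the lines of \<open>S\<close> that lie below \<open>x\<close>: it is
  \<open>x\<close> that is above them.\<close>

definition above :: "plane set set \<Rightarrow> plane \<Rightarrow> plane set set" where
  "above S x = {L \<in> S. f L x > 0}"

definition idx :: "plane set set \<Rightarrow> plane \<Rightarrow> nat" where
  "idx S x = card (above S x)"

text \<open>Counting from 0, so that the rung of rank \<open>m\<close> separates the cells
  \<open>m\<close> and \<open>Suc m\<close>.\<close>

definition rung_rank :: "plane set set \<Rightarrow> plane set \<Rightarrow> nat" where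
  "rung_rank S L = card {L' \<in> S. t L' < t L}"

text \<open>Cells are taken relative to the selected rungs \<open>S\<close> and not to all rungs,
  since they are to be the faces of the graph formed by \<open>S\<close>.\<close>

definition cell :: "plane set set \<Rightarrow> nat \<Rightarrow> plane set" where
  "cell S j = {x \<in> D - \<Union>S. idx S x = j}"

lemma rungsD: "L \<in> rungs \<Longrightarrow> L \<in> T" "L \<in> rungs \<Longrightarrow> p L \<in> D" "L \<in> rungs \<Longrightarrow> n L \<bullet> v > 0"
  using rung_in_D normal_pos by (auto simp: rungs_def p_def)

lemma finite_rungs_subset: "S \<subseteq> rungs \<Longrightarrow> finite S"
  using finite_rungs finite_subset unfolding rungs_def by blast

lemma mem_rung_iff: "L \<in> rungs \<Longrightarrow> x \<in> L \<longleftrightarrow> f L x = 0"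
  using rung_eq[of L] by (auto simp: rungs_def f_def p_def)

lemma p_mem: "L \<in> rungs \<Longrightarrow> p L \<in> L"
  by (simp add: mem_rung_iff f_def)

lemma same_line:
  assumes "L \<in> T" "L' \<in> T" "x \<in> L" "x \<in> L'" "x \<in> closure D"
  shows "L = L'"
  using unique_line_through_non_node[OF assms(1-4)] assms(5) no_nodes by blast

lemma same_line_D: "L \<in> T \<Longrightarrow> L' \<in> T \<Longrightarrow> x \<in> L \<Longrightarrow> x \<in> L' \<Longrightarrow> x \<in> D \<Longrightarrow> L = L'"
  using same_line closure_subset by blast

lemma f_shift: "f L (x + s *\<^sub>R v) = f L x + s * (n L \<bullet> v)"
  by (simp add: f_def inner_diff_right inner_add_right)

lemma f_p: "f L (p L') = (t L' - t L) * (n L \<bullet> v)"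
  by (simp add: f_def p_def inner_diff_right inner_add_right algebra_simps)

lemma continuous_f: "continuous_on UNIV (f L)"
  unfolding f_def by (intro continuous_intros)

lemma f_zero_between:
  assumes "connected C" "x \<in> C" "y \<in> C" "f L x \<le> 0" "f L y \<ge> 0"
  shows "\<exists>z\<in>C. f L z = 0"
  using connected_ivt_hyperplane[OF assms(1-3), of "n L" "n L \<bullet> p L"] assms(4,5)
  by (auto simp: f_def inner_diff_right)

section \<open>Linear order of the rungs\<close>

lemma inj_on_t: "inj_on t rungs"
proof (rule inj_onI)
  fix L L' assume L: "L \<in> rungs" "L' \<in> rungs" "t L = t L'"
  then have "p L = p L'" by (simp add: p_def)
  then show "L = L'" using L same_line_D[of L L' "p L"] rungsD p_mem by metis
qed

text \<open>Chords do not cross inside \<open>D\<close>, so \<open>f L'\<close> has no zero on the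
  connected chord \<open>L \<inter> D\<close> and keeps the sign it has at \<open>p L\<close>, which
  is that of \<open>t L - t L'\<close>.\<close>

lemma sign_on_rung:
  assumes L: "L \<in> rungs" "L' \<in> rungs" "L \<noteq> L'" and y: "y \<in> L \<inter> D"
  shows "f L' y \<noteq> 0" and "f L' y > 0 \<longleftrightarrow> t L' < t L"
proof -
  have nz: "f L' z \<noteq> 0" if "z \<in> L \<inter> D" for z
    using same_line_D[of L L' z] that L rungsD mem_rung_iff by auto
  show "f L' y \<noteq> 0" using nz y by blast
  have C: "connected (L \<inter> D)"
    using convex_Int[OF straight_line_convex[OF lines[OF rungsD(1)[OF L(1)]]] convex_D] convex_connected by blast
  have pL: "p L \<in> L \<inter> D" using L rungsD p_mem by blast
  have tt: "t L \<noteq> t L'" using inj_on_t L by (auto dest: inj_onD)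
  show "f L' y > 0 \<longleftrightarrow> t L' < t L"
  proof
    assume "f L' y > 0"
    then have "f L' (p L) > 0"
      using f_zero_between[OF C pL y, of L'] nz by force
    then show "t L' < t L"
      using rungsD(3)[OF L(2)] by (simp add: f_p zero_less_mult_iff)
  next
    assume "t L' < t L"
    then have "f L' (p L) > 0"
      using rungsD(3)[OF L(2)] by (simp add: f_p zero_less_mult_iff)
    then show "f L' y > 0"
      using f_zero_between[OF C y pL, of L'] nz by force
  qed
qed

lemma f_line_comb: "f L ((1 - u) *\<^sub>R x + u *\<^sub>R y) = (1 - u) * f L x + u * f L y"
  by (simp add: f_def inner_diff_right inner_add_right algebra_simps)

text \<open>Otherwise the segment from \<open>x\<close> to \<open>p L\<close> would cross
  \<open>L'\<close>. Before its endpoint this segment runs strictly above \<open>L\<close>, so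
  \<open>L'\<close> would have a point above \<open>L\<close> and could not be the lower
  rung.\<close>

lemma above_nested:
  assumes L: "L \<in> rungs" "L' \<in> rungs" "t L' < t L" and x: "x \<in> D" "f L x > 0"
  shows "f L' x > 0"
proof (rule ccontr)
  assume "\<not> f L' x > 0"
  moreover have pos: "f L' (p L) > 0"
    using rungsD(3)[OF L(2)] L(3) by (simp add: f_p zero_less_mult_iff)
  ultimately obtain z where z: "z \<in> closed_segment x (p L)" "f L' z = 0"
    using f_zero_between[of "closed_segment x (p L)" x "p L" L'] by auto
  then obtain u where u: "0 \<le> u" "u \<le> 1" "z = (1 - u) *\<^sub>R x + u *\<^sub>R p L"
    by (auto simp: in_segment)
  have "u \<noteq> 1" using u z pos by auto
  moreover have "f L (p L) = 0" by (simp add: f_def)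
  ultimately have "f L z > 0" using u x by (simp add: f_line_comb)
  moreover have "z \<in> L' \<inter> D"
    using z mem_rung_iff[OF L(2)] closed_segment_subset[OF x(1) rungsD(2)[OF L(1)] convex_D] by blast
  ultimately have "t L < t L'" using sign_on_rung[OF L(2,1)] L(3) by auto
  then show False using L(3) by simp
qed

text \<open>By nestedness the sets \<open>above S x\<close> for \<open>x\<close> in \<open>D\<close>
  form a chain under inclusion, and members of a finite chain are determined by their size. This is
  why a number can serve as the name of a cell.\<close>

lemma idx_eq_iff:
  assumes S: "S \<subseteq> rungs" and x: "x \<in> D" "y \<in> D"
  shows "idx S x = idx S y \<longleftrightarrow> above S x = above S y"
proof
  assume eq: "idx S x = idx S y"
  have fin: "finite (above S x)" "finite (above S y)"
    using finite_rungs_subset[OF S] by (auto simp: above_def)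
  have "above S x \<subseteq> above S y \<or> above S y \<subseteq> above S x"
  proof (rule ccontr)
    assume "\<not> ?thesis"
    then obtain L L' where LL: "L \<in> above S x" "L \<notin> above S y" "L' \<in> above S y" "L' \<notin> above S x"
      by blast
    then have SS: "L \<in> rungs" "L' \<in> rungs" using S by (auto simp: above_def)
    have "t L \<noteq> t L'" using inj_onD[OF inj_on_t _ SS] LL by auto
    then show False
      using above_nested[OF SS _ x(1)] above_nested[OF SS(2,1) _ x(2)] LL
      by (auto simp: above_def neq_iff)
  qed
  then show "above S x = above S y"
    using eq card_subset_eq fin unfolding idx_def by metis
qed (simp add: idx_def)

lemma idx_le_card: "S \<subseteq> rungs \<Longrightarrow> idx S x \<le> card S"
  unfolding idx_def above_def by (intro card_mono finite_rungs_subset) auto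

lemma f_nonzero_off: "S \<subseteq> rungs \<Longrightarrow> x \<notin> \<Union>S \<Longrightarrow> L \<in> S \<Longrightarrow> f L x \<noteq> 0"
  using mem_rung_iff by blast

section \<open>Cells as connected components\<close>

text \<open>Equal indices mean equal sign patterns, so a cell behaves like an intersection of
  \<open>D\<close> with open half-planes.\<close>

lemma convex_cell:
  assumes S: "S \<subseteq> rungs"
  shows "convex (cell S j)"
  unfolding convex_alt
proof (intro ballI allI impI)
  fix x y u assume xy: "x \<in> cell S j" "y \<in> cell S j" and u: "0 \<le> u \<and> u \<le> (1::real)"
  let ?z = "(1 - u) *\<^sub>R x + u *\<^sub>R y"
  have D: "x \<in> D" "y \<in> D" "x \<notin> \<Union>S" "y \<notin> \<Union>S" using xy by (auto simp: cell_def)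
  have eq: "above S x = above S y" using idx_eq_iff[OF S D(1,2)] xy by (auto simp: cell_def)
  have zD: "?z \<in> D" using convex_D D u unfolding convex_alt by blast
  have sgn: "f L ?z \<noteq> 0 \<and> (f L ?z > 0 \<longleftrightarrow> f L x > 0)" if L: "L \<in> S" for L
  proof -
    have same: "f L x > 0 \<longleftrightarrow> f L y > 0"
      using arg_cong[OF eq, of "\<lambda>A. L \<in> A"] L by (simp add: above_def)
    have nz: "f L x \<noteq> 0" "f L y \<noteq> 0"
      using f_nonzero_off[OF S D(3) L] f_nonzero_off[OF S D(4) L] .
    show ?thesis
    proof (cases "f L x > 0")
      case True
      \<comment> \<open>Negated because \<open>convex_bound_lt\<close> bounds convex combinations
        from above.\<close>
      then have "(1 - u) * - f L x + u * - f L y < 0"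
        using same u by (intro convex_bound_lt) auto
      then show ?thesis using True by (simp add: f_line_comb)
    next
      case False
      then have "(1 - u) * f L x + u * f L y < 0"
        using same nz u by (intro convex_bound_lt) auto
      then show ?thesis using False by (simp add: f_line_comb)
    qed
  qed
  have "above S ?z = above S x" using sgn by (auto simp: above_def)
  moreover have "?z \<notin> \<Union>S" using sgn S mem_rung_iff by blast
  ultimately show "?z \<in> cell S j" using zD xy by (auto simp: cell_def idx_def)
qed

lemma cell_subset: "cell S j \<subseteq> D - \<Union>S"
  by (auto simp: cell_def)

text \<open>A cell is convex, hence connected; conversely, a connected set that avoids
  \<open>S\<close> cannot change the sign of any \<open>f L\<close>, by the intermediate value
  theorem.\<close>

lemma connected_component_cell:
  assumes S: "S \<subseteq> rungs" and x: "x \<in> D - \<Union>S"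
  shows "connected_component_set (D - \<Union>S) x = cell S (idx S x)"
proof
  have "x \<in> cell S (idx S x)" using x by (simp add: cell_def)
  then show "cell S (idx S x) \<subseteq> connected_component_set (D - \<Union>S) x"
    by (intro connected_component_maximal convex_connected convex_cell S cell_subset)
  show "connected_component_set (D - \<Union>S) x \<subseteq> cell S (idx S x)"
  proof
    fix z assume "z \<in> connected_component_set (D - \<Union>S) x"
    then obtain C where C: "connected C" "C \<subseteq> D - \<Union>S" "x \<in> C" "z \<in> C"
      by (auto simp: connected_component_def)
    have "f L z > 0 \<longleftrightarrow> f L x > 0" if L: "L \<in> S" for L
      using f_zero_between[OF C(1,3,4), of L] f_zero_between[OF C(1,4,3), of L] f_nonzero_off[OF S _ L] C(2) L
      by force
    then have "above S z = above S x" by (auto simp: above_def)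
    then show "z \<in> cell S (idx S x)" using C by (auto simp: cell_def idx_def)
  qed
qed

lemma components_subset_cells:
  assumes S: "S \<subseteq> rungs"
  shows "components (D - \<Union>S) = (\<lambda>x. cell S (idx S x)) ` (D - \<Union>S)"
  using connected_component_cell[OF S] by (auto simp: components_def)

section \<open>Adjacency of rungs and cells\<close>

text \<open>At \<open>y\<close> the other finitely many functions \<open>f L'\<close> are nonzero
  with signs dictated by the order, and by continuity they keep them nearby. Only the sign of
  \<open>f L\<close> is left open, and it selects one of two consecutive cells.\<close>

lemma near_rung:
  assumes S: "S \<subseteq> rungs" and L: "L \<in> S" and y: "y \<in> L \<inter> D"
  shows "\<exists>e>0. ball y e \<subseteq> D \<and> (\<forall>x\<in>ball y e.
    (f L x > 0 \<longrightarrow> x \<in> cell S (Suc (rung_rank S L))) \<and> (f L x < 0 \<longrightarrow> x \<in> cell S (rung_rank S L)))"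
proof -
  have fin: "finite S" using finite_rungs_subset[OF S] .
  have LR: "L \<in> rungs" using S L by blast
  have cont: "(f L' \<longlongrightarrow> f L' y) (nhds y)" for L'
    using continuous_f by (auto simp: continuous_on_eq_continuous_at isCont_def tendsto_nhds_iff)
  have "eventually (\<lambda>x. f L' x \<noteq> 0 \<and> (f L' x > 0 \<longleftrightarrow> t L' < t L)) (nhds y)" if L': "L' \<in> S - {L}" for L'
  proof (cases "f L' y > 0")
    case True
    have "L' \<in> rungs" "L \<noteq> L'" using L' S by auto
    note sgn = sign_on_rung[OF LR this y]
    from True have "t L' < t L" using sgn by simp
    then show ?thesis using order_tendstoD(1)[OF cont True] by (auto elim!: eventually_mono)
  next
    case False
    have "L' \<in> rungs" "L \<noteq> L'" using L' S by auto
    note sgn = sign_on_rung[OF LR this y]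
    from False have "f L' y < 0" "\<not> t L' < t L" using sgn by auto
    then show ?thesis using order_tendstoD(2)[OF cont, of L' 0] by (auto elim!: eventually_mono)
  qed
  then have "eventually (\<lambda>x. \<forall>L'\<in>S - {L}. f L' x \<noteq> 0 \<and> (f L' x > 0 \<longleftrightarrow> t L' < t L)) (nhds y)"
    using fin by (intro eventually_ball_finite) auto
  moreover have "eventually (\<lambda>x. x \<in> D) (nhds y)"
    using open_D y by (auto simp: eventually_nhds)
  ultimately have "eventually (\<lambda>x. x \<in> D \<and> (\<forall>L'\<in>S - {L}. f L' x \<noteq> 0 \<and> (f L' x > 0 \<longleftrightarrow> t L' < t L))) (nhds y)"
    by (rule eventually_conj[rotated])
  then obtain e where e: "e > 0" "\<And>x. dist x y < e \<Longrightarrow> x \<in> D"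
    "\<And>x L'. dist x y < e \<Longrightarrow> L' \<in> S \<Longrightarrow> L' \<noteq> L \<Longrightarrow> f L' x \<noteq> 0 \<and> (f L' x > 0 \<longleftrightarrow> t L' < t L)"
    unfolding eventually_nhds_metric by (metis DiffI singletonD)
  have off: "x \<notin> \<Union>S" if "dist x y < e" "f L x \<noteq> 0" for x
    using e(3)[OF that(1)] that(2) S mem_rung_iff by (metis UnionE subsetD)
  have "x \<in> cell S (Suc (rung_rank S L))" if x: "x \<in> ball y e" and f: "f L x > 0" for x
  proof -
    have d: "dist x y < e" using x by (simp add: dist_commute)
    have "above S x = insert L {L' \<in> S. t L' < t L}"
      using f e(3)[OF d] L by (auto simp: above_def)
    then have "idx S x = Suc (rung_rank S L)" using fin by (simp add: idx_def rung_rank_def)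
    then show ?thesis using e(2)[OF d] off[OF d] f by (simp add: cell_def)
  qed
  moreover have "x \<in> cell S (rung_rank S L)" if x: "x \<in> ball y e" and f: "f L x < 0" for x
  proof -
    have d: "dist x y < e" using x by (simp add: dist_commute)
    have "f L' x > 0 \<longleftrightarrow> t L' < t L" if "L' \<in> S" for L'
      using f e(3)[OF d that] by (cases "L' = L") auto
    then have "above S x = {L' \<in> S. t L' < t L}" by (auto simp: above_def)
    then have "idx S x = rung_rank S L" by (simp add: idx_def rung_rank_def)
    then show ?thesis using e(2)[OF d] off[OF d] f by (simp add: cell_def)
  qed
  moreover have "ball y e \<subseteq> D" using e(2) by (auto simp: dist_commute)
  ultimately show ?thesis using e(1) by blast
qed

lemma rung_in_closure_cell_iff:
  assumes S: "S \<subseteq> rungs" and L: "L \<in> S" and y: "y \<in> L \<inter> D"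
  shows "y \<in> closure (cell S j) \<longleftrightarrow> j = rung_rank S L \<or> j = Suc (rung_rank S L)"
proof -
  obtain e where e: "e > 0" "ball y e \<subseteq> D"
    "\<And>x. x \<in> ball y e \<Longrightarrow> f L x > 0 \<Longrightarrow> x \<in> cell S (Suc (rung_rank S L))"
    "\<And>x. x \<in> ball y e \<Longrightarrow> f L x < 0 \<Longrightarrow> x \<in> cell S (rung_rank S L)"
    using near_rung[OF S L y] by blast
  have LR: "L \<in> rungs" using S L by blast
  have fy: "f L y = 0" using y mem_rung_iff LR by blast
  have nv: "n L \<bullet> v > 0" using rungsD LR by blast
  then have vnz: "norm v > 0" by auto
  show ?thesis
  proof
    assume "y \<in> closure (cell S j)"
    then obtain x where x: "x \<in> cell S j" "dist x y < e" using e(1) by (auto simp: closure_approachable)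
    have "f L x \<noteq> 0" using f_nonzero_off[OF S _ L] x by (auto simp: cell_def)
    then have "x \<in> cell S (Suc (rung_rank S L)) \<or> x \<in> cell S (rung_rank S L)"
      using e(3)[of x] e(4)[of x] x by (auto simp: dist_commute neq_iff)
    then show "j = rung_rank S L \<or> j = Suc (rung_rank S L)" using x by (auto simp: cell_def)
  next
    assume j: "j = rung_rank S L \<or> j = Suc (rung_rank S L)"
    show "y \<in> closure (cell S j)"
      unfolding closure_approachable
    proof (intro allI impI)
      fix d :: real assume d: "d > 0"
      \<comment> \<open>A displacement by \<open>s *\<^sub>R v\<close> has length
        \<open>min d e / 2\<close>, below both the required precision \<open>d\<close> and the
        radius \<open>e\<close> of the good ball; the sign in front of \<open>s\<close> chooses the
        side of \<open>L\<close>.\<close>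
      define s where "s = min d e / (2 * norm v)"
      have s: "s > 0" using d e(1) vnz by (simp add: s_def)
      have "s * norm v = min d e / 2" using vnz by (simp add: s_def)
      then have sd: "s * norm v < d" "s * norm v < e" using d e(1) by auto
      show "\<exists>x\<in>cell S j. dist x y < d"
      proof (cases "j = rung_rank S L")
        case True
        have "y + (- s) *\<^sub>R v \<in> cell S j"
          unfolding True
          by (rule e(4)) (use s sd nv fy f_shift[of L y "-s"] in \<open>auto simp: dist_norm\<close>)
        then show ?thesis using sd s by (intro bexI) (auto simp: dist_norm)
      next
        case False
        then have j': "j = Suc (rung_rank S L)" using j by simp
        have "y + s *\<^sub>R v \<in> cell S j"
          unfolding j'
          by (rule e(3)) (use s sd nv fy f_shift[of L y s] in \<open>auto simp: dist_norm\<close>)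
        then show ?thesis using sd s by (intro bexI) (auto simp: dist_norm)
      qed
    qed
  qed
qed

lemma rung_in_frontier_cell_iff:
  assumes S: "S \<subseteq> rungs" and L: "L \<in> S" and y: "y \<in> L \<inter> D"
  shows "y \<in> frontier (cell S j) \<longleftrightarrow> j = rung_rank S L \<or> j = Suc (rung_rank S L)"
proof -
  have "y \<notin> interior (cell S j)"
    using interior_subset[of "cell S j"] cell_subset[of S j] y L by blast
  then show ?thesis using rung_in_closure_cell_iff[OF assms] by (simp add: frontier_def)
qed

text \<open>This makes the adjacency of cells a path: every gap between consecutive indices is
  occupied by exactly one rung.\<close>

lemma bij_betw_rank:
  assumes S: "S \<subseteq> rungs"
  shows "bij_betw (rung_rank S) S {..<card S}"
proof -
  have fin: "finite S" using finite_rungs_subset[OF S] .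
  have less: "rung_rank S L < rung_rank S L'" if "L \<in> S" "t L < t L'" for L L'
    unfolding rung_rank_def using that fin by (intro psubset_card_mono) auto
  have inj: "inj_on (rung_rank S) S"
  proof (rule inj_onI)
    fix L L' assume L: "L \<in> S" "L' \<in> S" "rung_rank S L = rung_rank S L'"
    then have "t L = t L'" using less by (metis less_irrefl neq_iff)
    then show "L = L'" using inj_onD[OF inj_on_t] L S by blast
  qed
  have "rung_rank S ` S \<subseteq> {..<card S}"
    unfolding rung_rank_def using fin by (auto intro!: psubset_card_mono)
  then have "rung_rank S ` S = {..<card S}"
    by (intro card_subset_eq) (auto simp: card_image inj)
  with inj show ?thesis by (simp add: bij_betw_def)
qed

lemma cell_nonempty:
  assumes S: "S \<subseteq> rungs" and j: "j \<le> card S"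
  shows "cell S j \<noteq> {}"
proof (cases "S = {}")
  case True
  then show ?thesis using ne_D j by (auto simp: cell_def idx_def above_def)
next
  case False
  then have "card S > 0" using finite_rungs_subset[OF S] by (simp add: card_gt_0_iff)
  \<comment> \<open>The cell \<open>j\<close> touches the rung of rank \<open>j\<close>, except for
    the top cell \<open>j = card S\<close>, which is reached from the rung of rank
    \<open>card S - 1\<close>.\<close>
  then obtain i where i: "i < card S" "j = i \<or> j = Suc i"
    using j by (cases "j < card S") (auto intro: that[of "card S - 1"])
  then obtain L where L: "L \<in> S" "rung_rank S L = i"
    using bij_betw_imp_surj_on[OF bij_betw_rank[OF S]] by (metis imageE lessThan_iff)
  have "p L \<in> L \<inter> D" using L S p_mem rungsD by blast
  then have "p L \<in> closure (cell S j)" using rung_in_closure_cell_iff[OF S L(1)] i L by simp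
  then show ?thesis by auto
qed

lemma components_eq_cells:
  assumes S: "S \<subseteq> rungs"
  shows "components (D - \<Union>S) = cell S ` {..card S}"
proof -
  have "idx S ` (D - \<Union>S) = {..card S}"
  proof
    show "{..card S} \<subseteq> idx S ` (D - \<Union>S)"
    proof
      fix j assume "j \<in> {..card S}"
      then obtain x where "x \<in> cell S j" using cell_nonempty[OF S] by blast
      then show "j \<in> idx S ` (D - \<Union>S)" unfolding cell_def by blast
    qed
  qed (use idx_le_card[OF S] in auto)
  then show ?thesis unfolding components_subset_cells[OF S] by (metis image_image)
qed

end

section \<open>Configurations in a chain of cells\<close>

text \<open>\<open>m\<close> counts the edges of the path, so its vertices are \<open>0\<close> to
  \<open>m\<close>. Extensionality makes functions with the same colours equal, as counting
  requires.\<close>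

definition colourings :: "nat \<Rightarrow> nat \<Rightarrow> (nat \<Rightarrow> nat) set" where
  "colourings k m = {g \<in> {..m} \<rightarrow>\<^sub>E {1..k}. \<forall>i<m. g i \<noteq> g (Suc i)}"

lemma finite_colourings: "finite (colourings k m)"
  unfolding colourings_def by (rule finite_subset[OF _ finite_PiE[of "{..m}" "\<lambda>_. {1..k}"]]) auto

lemma colourings_Suc:
  "bij_betw (\<lambda>(g, c). g(Suc m := c)) (SIGMA g:colourings k m. {1..k} - {g m}) (colourings k (Suc m))"
  (is "bij_betw ?F ?A ?B")
proof (rule bij_betw_byWitness[where f' = "\<lambda>h. (restrict h {..m}, h (Suc m))"])
  show "\<forall>a\<in>?A. (restrict (?F a) {..m}, ?F a (Suc m)) = a"
    by (auto simp: colourings_def fun_eq_iff PiE_iff extensional_def)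
  show "\<forall>h\<in>?B. ?F (restrict h {..m}, h (Suc m)) = h"
    by (auto simp: colourings_def fun_eq_iff PiE_iff extensional_def le_Suc_eq)
  show "?F ` ?A \<subseteq> ?B"
    by (auto simp: colourings_def PiE_iff extensional_def less_Suc_eq)
  show "(\<lambda>h. (restrict h {..m}, h (Suc m))) ` ?B \<subseteq> ?A"
    by (auto simp: colourings_def PiE_iff Suc_le_eq)
qed

lemma card_colourings: "card (colourings k m) = k * (k - 1) ^ m"
proof (induction m)
  case 0
  have "colourings k 0 = {..0} \<rightarrow>\<^sub>E {1..k}" by (simp add: colourings_def)
  then show ?case by (simp add: card_PiE)
next
  case (Suc m)
  have "g m \<in> {1..k}" if "g \<in> colourings k m" for g
    using that by (auto simp: colourings_def PiE_iff)
  then have "card ({1..k} - {g m}) = k - 1" if "g \<in> colourings k m" for g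
    using that by (simp add: card_Diff_singleton)
  then have "card (SIGMA g:colourings k m. {1..k} - {g m}) = card (colourings k m) * (k - 1)"
    by (simp add: card_SigmaI finite_colourings)
  then show ?case
    using bij_betw_same_card[OF colourings_Suc[of m k]] Suc.IH by (simp add: ac_simps)
qed

context ladder
begin

section \<open>Graphs in a window without nodes\<close>

definition graph_of :: "plane set set \<Rightarrow> plane set" where
  "graph_of S = (\<Union>L\<in>S. closure (L \<inter> D))"

definition colour :: "plane set set \<Rightarrow> (nat \<Rightarrow> nat) \<Rightarrow> plane \<Rightarrow> nat" where
  "colour S g x = (if x \<in> D - \<Union>S then g (idx S x) else 0)"

lemma closure_rung:
  assumes "L \<in> T" "x \<in> closure (L \<inter> D)"
  shows "x \<in> L" "x \<in> closure D"
proof -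
  have "closure (L \<inter> D) \<subseteq> closure L \<inter> closure D" by (simp add: closure_mono)
  then show "x \<in> L" "x \<in> closure D"
    using assms straight_line_closed[OF lines[OF assms(1)]] by auto
qed

lemma closure_rung_Int_D: "L \<in> T \<Longrightarrow> closure (L \<inter> D) \<inter> D = L \<inter> D"
  using closure_rung closure_subset[of "L \<inter> D"] by blast

lemma graph_of_Int_D: "S \<subseteq> rungs \<Longrightarrow> x \<in> D \<Longrightarrow> x \<in> graph_of S \<longleftrightarrow> x \<in> \<Union>S"
  using closure_rung_Int_D rungsD(1) unfolding graph_of_def by blast

lemma D_minus_graph: "S \<subseteq> rungs \<Longrightarrow> D - graph_of S = D - \<Union>S"
  using graph_of_Int_D by blast

lemma rung_connected: "L \<in> rungs \<Longrightarrow> connected (L \<inter> D)"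
  using convex_Int[OF straight_line_convex[OF lines[OF rungsD(1)]] convex_D] convex_connected by blast

lemma components_rung: "L \<in> rungs \<Longrightarrow> components (L \<inter> D) = {L \<inter> D}"
  by (simp add: components_eq_sing_iff rung_connected) (simp add: rungs_def)

lemma components_closure_rung: "L \<in> rungs \<Longrightarrow> components (closure (L \<inter> D)) = {closure (L \<inter> D)}"
  by (simp add: components_eq_sing_iff connected_imp_connected_closure rung_connected) (simp add: rungs_def)

lemma rung_unique:
  assumes "L \<in> rungs" "L' \<in> T" "L \<inter> D \<subseteq> L'"
  shows "L = L'"
  using same_line_D[of L L' "p L"] assms rungsD p_mem by blast

lemma inj_on_rung: "inj_on (\<lambda>L. L \<inter> D) rungs"
  by (rule inj_onI) (metis rung_unique rungsD(1) inf_le1)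

lemma inj_on_closure_rung: "inj_on (\<lambda>L. closure (L \<inter> D)) rungs"
  by (rule inj_onI) (metis closure_rung_Int_D rung_unique rungsD(1) inf_le1)

lemma nodes_Int_D: "D \<inter> nodes T = {}"
  using no_nodes closure_subset by blast

lemma segments_eq: "segments T D = (\<lambda>L. L \<inter> D) ` rungs"
proof -
  have "components (L \<inter> D - nodes T) = (if L \<in> rungs then {L \<inter> D} else {})" if "L \<in> T" for L
  proof -
    have "L \<inter> D - nodes T = L \<inter> D" using nodes_Int_D by blast
    then show ?thesis using that components_rung[of L] by (auto simp: rungs_def)
  qed
  then have "segments T D = (\<Union>L\<in>T. if L \<in> rungs then {L \<inter> D} else {})"
    unfolding segments_def by (intro SUP_cong) auto
  also have "\<dots> = (\<lambda>L. L \<inter> D) ` rungs"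
    using rungsD(1) by auto
  finally show ?thesis .
qed

text \<open>A chord contained in the union of the chords of \<open>S\<close> is one of them: its
  point \<open>p L\<close> lies on some line of \<open>S\<close>, and two lines of \<open>T\<close>
  do not meet in \<open>D\<close>.\<close>

lemma graph_segments_eq:
  assumes S: "S \<subseteq> rungs"
  shows "graph_segments T D (graph_of S) = (\<lambda>L. L \<inter> D) ` S"
proof
  show "graph_segments T D (graph_of S) \<subseteq> (\<lambda>L. L \<inter> D) ` S"
  proof
    fix s assume "s \<in> graph_segments T D (graph_of S)"
    then obtain L where L: "L \<in> rungs" "s = L \<inter> D" "s \<subseteq> graph_of S"
      by (auto simp: graph_segments_def segments_eq)
    have "p L \<in> L \<inter> D" using L p_mem rungsD by blast
    then have "p L \<in> graph_of S" "p L \<in> D" "p L \<in> L" using L by blast+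
    then obtain L' where "L' \<in> S" "p L \<in> L'" using graph_of_Int_D[OF S] by blast
    then have "L = L'" using same_line_D[of L L' "p L"] \<open>p L \<in> D\<close> \<open>p L \<in> L\<close> rungsD(1) S L(1) by blast
    then show "s \<in> (\<lambda>L. L \<inter> D) ` S" using L \<open>L' \<in> S\<close> by blast
  qed
  show "(\<lambda>L. L \<inter> D) ` S \<subseteq> graph_segments T D (graph_of S)"
  proof
    fix s assume "s \<in> (\<lambda>L. L \<inter> D) ` S"
    then obtain L where L: "L \<in> S" "s = L \<inter> D" by blast
    then have "s \<subseteq> graph_of S" using closure_subset[of "L \<inter> D"] by (auto simp: graph_of_def)
    then show "s \<in> graph_segments T D (graph_of S)"
      using L S by (auto simp: graph_segments_def segments_eq)
  qed
qed

lemma graph_of_inj: "S \<subseteq> rungs \<Longrightarrow> S' \<subseteq> rungs \<Longrightarrow> graph_of S = graph_of S' \<Longrightarrow> S = S'"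
  using graph_segments_eq inj_on_image_eq_iff[OF inj_on_rung] by metis

lemma is_graph_iff: "is_graph T D \<gamma> \<longleftrightarrow> (\<exists>S\<subseteq>rungs. \<gamma> = graph_of S)"
  unfolding is_graph_def segments_eq graph_of_def
  by (auto simp: subset_image_iff image_image)

text \<open>A single point thus tests the presence of a rung, which lets events about chords be read
  off from the whole-plane graph.\<close>

lemma p_mem_graph_iff:
  assumes "S \<subseteq> rungs" "L \<in> rungs"
  shows "p L \<in> graph_of S \<longleftrightarrow> L \<in> S"
proof -
  have "p L \<in> \<Union>S \<longleftrightarrow> L \<in> S"
    using same_line_D[of L _ "p L"] assms rungsD p_mem by blast
  then show ?thesis using graph_of_Int_D assms rungsD(2) by blast
qed

lemma interior_vertices_eq: "interior_vertices T D \<gamma> = {}"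
  using nodes_Int_D by (auto simp: interior_vertices_def)

text \<open>Two chords ending in the same boundary point would create a node on the frontier; here
  the absence of nodes in the closure of \<open>D\<close> is essential.\<close>

lemma degree_boundary:
  assumes S: "S \<subseteq> rungs" and x: "x \<in> boundary_vertices D (graph_of S)"
  shows "degree_at T D (graph_of S) x = 1"
proof -
  obtain L where L: "L \<in> S" "x \<in> closure (L \<inter> D)"
    using x by (auto simp: boundary_vertices_def graph_of_def)
  have "L' = L" if "L' \<in> S" "x \<in> closure (L' \<inter> D)" for L'
    using same_line[of L' L x] closure_rung[of L x] closure_rung[of L' x] that L S rungsD(1) by blast
  then have "segments_at T D (graph_of S) x = {L \<inter> D}"
    using L unfolding segments_at_def graph_segments_eq[OF S] by blast
  then show ?thesis by (simp add: degree_at_def)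
qed

lemma line_part_eq:
  assumes S: "S \<subseteq> rungs" and L: "L \<in> T"
  shows "line_part T D (graph_of S) L = (if L \<in> S then closure (L \<inter> D) else {})"
proof -
  have "L' \<inter> D \<subseteq> L \<longleftrightarrow> L' = L" if "L' \<in> S" for L'
    using rung_unique[of L' L] that S L by blast
  then have "{s \<in> graph_segments T D (graph_of S). s \<subseteq> L} = (if L \<in> S then {L \<inter> D} else {})"
    unfolding graph_segments_eq[OF S] by auto
  then show ?thesis by (simp add: line_part_def)
qed

lemma edges_eq:
  assumes S: "S \<subseteq> rungs"
  shows "edges T D (graph_of S) = (\<lambda>L. L \<inter> D) ` S"
proof -
  have ST: "S \<subseteq> T" using S rungsD(1) by blast
  have "components (line_part T D (graph_of S) L \<inter> D - interior_vertices T D (graph_of S))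
      = (if L \<in> S then {L \<inter> D} else {})" if L: "L \<in> T" for L
  proof (cases "L \<in> S")
    case True
    then have "L \<in> rungs" using S by blast
    then show ?thesis
      using True by (simp add: line_part_eq[OF S L] interior_vertices_eq closure_rung_Int_D[OF L] components_rung)
  qed (simp add: line_part_eq[OF S L])
  then have "edges T D (graph_of S) = (\<Union>L\<in>T. if L \<in> S then {L \<inter> D} else {})"
    unfolding edges_def by (intro SUP_cong) auto
  also have "\<dots> = (\<lambda>L. L \<inter> D) ` S" using ST by auto
  finally show ?thesis .
qed

lemma primary_edges_eq:
  assumes S: "S \<subseteq> rungs"
  shows "primary_edges T D (graph_of S) = (\<lambda>L. closure (L \<inter> D)) ` S"
proof -
  have ST: "S \<subseteq> T" using S rungsD(1) by blast
  have "components (line_part T D (graph_of S) L) = (if L \<in> S then {closure (L \<inter> D)} else {})" if L: "L \<in> T" for L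
    using components_closure_rung[of L] S by (auto simp: line_part_eq[OF S L])
  then have "primary_edges T D (graph_of S) = (\<Union>L\<in>T. if L \<in> S then {closure (L \<inter> D)} else {})"
    unfolding primary_edges_def by (intro SUP_cong) auto
  also have "\<dots> = (\<lambda>L. closure (L \<inter> D)) ` S" using ST by auto
  finally show ?thesis .
qed

lemma line_of_closure_rung: "L \<in> rungs \<Longrightarrow> line_of T (closure (L \<inter> D)) = L"
  unfolding line_of_def
proof (rule the_equality)
  assume L: "L \<in> rungs"
  show "L \<in> T \<and> closure (L \<inter> D) \<subseteq> L" using closure_rung(1) rungsD(1)[OF L] by blast
  show "L' = L" if "L' \<in> T \<and> closure (L \<inter> D) \<subseteq> L'" for L'
    using rung_unique[OF L, of L'] that closure_subset[of "L \<inter> D"] by blast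
qed

lemma crossing_lines_rung: "L \<in> rungs \<Longrightarrow> crossing_lines T (L \<inter> D) = {}"
  using same_line_D[of L] rungsD(1)[of L] unfolding crossing_lines_def by blast

lemma graph_nodes_eq: "S \<subseteq> rungs \<Longrightarrow> graph_nodes T D (graph_of S) = {}"
proof -
  assume S: "S \<subseteq> rungs"
  have "\<Union>(edges T D (graph_of S)) \<subseteq> closure D"
    using closure_subset unfolding edges_eq[OF S] by blast
  moreover have "boundary_vertices D (graph_of S) \<subseteq> closure D"
    by (auto simp: boundary_vertices_def frontier_def)
  ultimately show ?thesis
    using no_nodes unfolding graph_nodes_def interior_vertices_eq by blast
qed

lemma card_edges: "S \<subseteq> rungs \<Longrightarrow> card (edges T D (graph_of S)) = card S"
  by (simp add: edges_eq card_image inj_on_subset[OF inj_on_rung])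

section \<open>Energy and weight of a configuration\<close>

text \<open>Without nodes there are no interior vertices, no lines crossing an edge and no graph
  nodes, so only the edge count survives.\<close>

lemma energy_eq:
  assumes S: "S \<subseteq> rungs" and k: "k \<ge> 2"
  shows "energy T \<pi> k \<alpha> D (graph_of S, c) = ereal (card S * ln (real k - 1))"
proof -
  have "vertices_of_degree T D (graph_of S) d = {}" for d
    by (simp add: vertices_of_degree_def interior_vertices_eq)
  then have "N_V T D (graph_of S) = 0" "N_T T D (graph_of S) = 0" "N_X T D (graph_of S) = 0"
    by (simp_all add: N_V_def N_T_def N_X_def)
  moreover have "(\<Sum>e\<in>edges T D (graph_of S). \<Sum>L\<in>crossing_lines T e. elog (1 - epsilon k \<alpha> * \<pi> L)) = 0"
    using crossing_lines_rung S unfolding edges_eq[OF S] by (intro sum.neutral) auto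
  \<comment> \<open>The vertex terms are 0 times a logarithm that may be infinite, for instance when
    \<alpha> is 0 or 1; the product in \<open>ereal\<close> is still 0.\<close>
  ultimately show ?thesis
    using k by (simp add: energy_def graph_nodes_eq[OF S] card_edges[OF S] elog_def)
qed

text \<open>Each chord is one edge and its closure one primary edge, so it contributes the cost
  factor 1 / (k - 1) and the activity \<open>\<pi> L\<close> once each.\<close>

lemma config_weight_eq:
  assumes S: "S \<subseteq> rungs" and k: "k \<ge> 2" and \<pi>: "\<And>L. L \<in> T \<Longrightarrow> 0 < \<pi> L"
  shows "config_weight T \<pi> k \<alpha> D (graph_of S, c) = ennreal ((\<Prod>L\<in>S. \<pi> L) / (real k - 1) ^ card S)"
proof -
  have "(\<Prod>e\<in>primary_edges T D (graph_of S). \<pi> (line_of T e)) = (\<Prod>L\<in>S. \<pi> (line_of T (closure (L \<inter> D))))"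
    unfolding primary_edges_eq[OF S] by (subst prod.reindex[OF inj_on_subset[OF inj_on_closure_rung S]]) simp
  also have "\<dots> = (\<Prod>L\<in>S. \<pi> L)" using line_of_closure_rung S by (intro prod.cong) auto
  finally have 1: "(\<Prod>e\<in>primary_edges T D (graph_of S). \<pi> (line_of T e)) = (\<Prod>L\<in>S. \<pi> L)" .
  have "exp (- (card S * ln (real k - 1))) = 1 / (real k - 1) ^ card S"
    using k by (simp add: exp_minus exp_of_nat_mult field_simps)
  then have "eexp (- energy T \<pi> k \<alpha> D (graph_of S, c)) = ennreal (1 / (real k - 1) ^ card S)"
    by (simp add: energy_eq[OF S k] eexp_def)
  then show ?thesis
    unfolding config_weight_def using k by (simp add: 1 ennreal_mult'[symmetric])
qed

section \<open>Configurations as coloured paths\<close>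

lemma faces_eq: "S \<subseteq> rungs \<Longrightarrow> faces D (graph_of S) = cell S ` {..card S}"
  by (simp add: faces_def D_minus_graph components_eq_cells)

lemma rung_frontier_cells_iff:
  assumes S: "S \<subseteq> rungs" and L: "L \<in> S"
  shows "L \<inter> D \<subseteq> frontier (cell S i) \<inter> frontier (cell S j) \<longleftrightarrow>
    {i, j} \<subseteq> {rung_rank S L, Suc (rung_rank S L)}"
proof -
  have "p L \<in> L \<inter> D" using L S p_mem rungsD by blast
  then show ?thesis using rung_in_frontier_cell_iff[OF S L] by blast
qed

lemma cell_eq_iff: "S \<subseteq> rungs \<Longrightarrow> i \<le> card S \<Longrightarrow> cell S i = cell S j \<longleftrightarrow> i = j"
  using cell_nonempty[of S i] by (auto simp: cell_def)

lemma colour_cell: "x \<in> cell S j \<Longrightarrow> colour S g x = g j"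
  by (auto simp: colour_def cell_def)

text \<open>A rung borders exactly the two cells numbered by its rank and the successor, and the
  ranks exhaust the numbers below \<open>card S\<close>.\<close>

lemma share_edge_iff:
  assumes S: "S \<subseteq> rungs" and "i \<noteq> j"
  shows "share_edge T D (graph_of S) (cell S i) (cell S j) \<longleftrightarrow>
    (\<exists>m<card S. {i, j} = {m, Suc m})"
proof -
  have "share_edge T D (graph_of S) (cell S i) (cell S j) \<longleftrightarrow>
      (\<exists>L\<in>S. {i, j} \<subseteq> {rung_rank S L, Suc (rung_rank S L)})"
    unfolding share_edge_def edges_eq[OF S] using rung_frontier_cells_iff[OF S] by auto
  also have "\<dots> \<longleftrightarrow> (\<exists>m\<in>rung_rank S ` S. {i, j} \<subseteq> {m, Suc m})" by blast
  also have "\<dots> \<longleftrightarrow> (\<exists>m<card S. {i, j} = {m, Suc m})"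
    unfolding bij_betw_imp_surj_on[OF bij_betw_rank[OF S]] using assms(2) by auto
  finally show ?thesis .
qed

lemma graph_colour_config:
  assumes S: "S \<subseteq> rungs" and g: "g \<in> colourings k (card S)"
  shows "(graph_of S, colour S g) \<in> configurations T k D"
proof -
  have g1: "g i \<in> {1..k}" if "i \<le> card S" for i using g that by (auto simp: colourings_def)
  have 1: "\<forall>x. if x \<in> D - graph_of S then colour S g x \<in> {1..k} else colour S g x = 0"
    using g1 idx_le_card[OF S] unfolding D_minus_graph[OF S] by (auto simp: colour_def)
  have 2: "colour S g constant_on F" if "F \<in> faces D (graph_of S)" for F
    using that unfolding faces_eq[OF S] constant_on_def by (auto simp: colour_cell)
  have 3: "\<exists>F\<in>faces D (graph_of S). \<exists>G\<in>faces D (graph_of S). F \<noteq> G \<and> e \<subseteq> frontier F \<inter> frontier G"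
    if e: "e \<in> edges T D (graph_of S)" for e
  proof -
    obtain L where L: "L \<in> S" "e = L \<inter> D" using e unfolding edges_eq[OF S] by blast
    have r: "rung_rank S L < card S" using bij_betwE[OF bij_betw_rank[OF S]] L(1) by blast
    show ?thesis
      unfolding faces_eq[OF S]
      by (rule bexI[of _ "cell S (rung_rank S L)"], rule bexI[of _ "cell S (Suc (rung_rank S L))"])
        (use r rung_frontier_cells_iff[OF S L(1)] cell_eq_iff[OF S] L(2) in auto)
  qed
  have 4: "colour S g x \<noteq> colour S g y"
    if FG: "F \<in> faces D (graph_of S)" "G \<in> faces D (graph_of S)" "F \<noteq> G" "share_edge T D (graph_of S) F G"
      and xy: "x \<in> F" "y \<in> G" for F G x y
  proof -
    obtain i j where ij: "F = cell S i" "G = cell S j" using FG unfolding faces_eq[OF S] by blast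
    then obtain m where "m < card S" "{i, j} = {m, Suc m}" using FG share_edge_iff[OF S, of i j] by auto
    moreover have "g m \<noteq> g (Suc m)" using g \<open>m < card S\<close> by (auto simp: colourings_def)
    ultimately have "g i \<noteq> g j" by (auto simp: doubleton_eq_iff)
    then show ?thesis using ij xy by (simp add: colour_cell)
  qed
  show ?thesis
    unfolding configurations_def mem_Collect_eq prod.case
  proof (intro conjI)
    show "is_graph T D (graph_of S)" using S is_graph_iff by blast
    show "\<forall>p\<in>interior_vertices T D (graph_of S). degree_at T D (graph_of S) p \<in> {2, 3, 4}"
      by (simp add: interior_vertices_eq)
    show "\<forall>p\<in>boundary_vertices D (graph_of S). degree_at T D (graph_of S) p = 1"
      using degree_boundary[OF S] by blast
  qed (use 1 2 3 4 in blast)+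
qed

lemma config_graph_colour:
  assumes c: "(\<gamma>, c) \<in> configurations T k D"
  obtains S g where "S \<subseteq> rungs" "g \<in> colourings k (card S)" "\<gamma> = graph_of S" "c = colour S g"
proof -
  have conf: "is_graph T D \<gamma>" "\<forall>x. if x \<in> D - \<gamma> then c x \<in> {1..k} else c x = 0"
    "\<forall>F\<in>faces D \<gamma>. c constant_on F"
    "\<forall>F\<in>faces D \<gamma>. \<forall>G\<in>faces D \<gamma>. F \<noteq> G \<and> share_edge T D \<gamma> F G \<longrightarrow> (\<forall>x\<in>F. \<forall>y\<in>G. c x \<noteq> c y)"
    using c unfolding configurations_def mem_Collect_eq prod.case by - (elim conjE, assumption)+
  obtain S where S: "S \<subseteq> rungs" "\<gamma> = graph_of S" using conf(1) is_graph_iff by blast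
  have c1: "if x \<in> D - \<Union>S then c x \<in> {1..k} else c x = 0" for x
    using conf(2) unfolding S(2) D_minus_graph[OF S(1)] by blast
  have c2: "c constant_on cell S j" if "j \<le> card S" for j
    using conf(3) that unfolding S(2) faces_eq[OF S(1)] by blast
  have c3: "c x \<noteq> c y" if "x \<in> cell S i" "y \<in> cell S (Suc i)" "i < card S" for x y i
  proof -
    have "share_edge T D (graph_of S) (cell S i) (cell S (Suc i))"
      using share_edge_iff[OF S(1), of i "Suc i"] that by auto
    moreover have "cell S i \<noteq> cell S (Suc i)" using cell_eq_iff[OF S(1), of i "Suc i"] that by simp
    moreover have "cell S i \<in> faces D \<gamma>" "cell S (Suc i) \<in> faces D \<gamma>"
      using that faces_eq[OF S(1)] S(2) by auto
    ultimately show ?thesis using conf(4) that S(2) by blast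
  qed
  \<comment> \<open>The colour is constant on each cell and the cells up to \<open>card S\<close>
    are nonempty, so any representative point gives the colour.\<close>
  define g where "g = (\<lambda>j\<in>{..card S}. c (SOME x. x \<in> cell S j))"
  have some: "(SOME x. x \<in> cell S j) \<in> cell S j" if "j \<le> card S" for j
    using cell_nonempty[OF S(1) that] some_in_eq by blast
  have g: "c x = g j" if "x \<in> cell S j" "j \<le> card S" for x j
    using c2[OF that(2)] that some[OF that(2)] unfolding constant_on_def g_def by auto
  have "g \<in> colourings k (card S)"
    unfolding colourings_def
  proof (intro CollectI conjI PiE_I allI impI)
    show "g j \<in> {1..k}" if "j \<in> {..card S}" for j
      using g[OF some] c1[of "SOME x. x \<in> cell S j"] some[of j] that by (auto simp: cell_def)
    show "g i \<noteq> g (Suc i)" if i: "i < card S" for i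
      using c3[OF some some i] g[OF some, of i] g[OF some, of "Suc i"] i by simp
  qed (simp add: g_def)
  moreover have "c = colour S g"
  proof
    fix x show "c x = colour S g x"
      using c1[of x] g[of x "idx S x"] idx_le_card[OF S(1), of x] by (auto simp: colour_def cell_def)
  qed
  ultimately show thesis using that S by blast
qed

text \<open>The graph recovers \<open>S\<close>, the colours on the nonempty cells recover
  \<open>g\<close> up to \<open>card S\<close>, and extensionality settles the remaining
  arguments.\<close>

lemma bij_betw_configurations:
  "bij_betw (\<lambda>(S, g). (graph_of S, colour S g)) (SIGMA S:Pow rungs. colourings k (card S)) (configurations T k D)"
  unfolding bij_betw_def
proof
  show "inj_on (\<lambda>(S, g). (graph_of S, colour S g)) (SIGMA S:Pow rungs. colourings k (card S))"
  proof (rule inj_onI, clarify)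
    fix S g S' g'
    assume S: "S \<subseteq> rungs" "S' \<subseteq> rungs" and g: "g \<in> colourings k (card S)" "g' \<in> colourings k (card S')"
      and eq: "graph_of S = graph_of S'" "colour S g = colour S' g'"
    have SS: "S = S'" using graph_of_inj[OF S eq(1)] .
    have "g j = g' j" for j
    proof (cases "j \<le> card S")
      case True
      then obtain x where "x \<in> cell S j" using cell_nonempty[OF S(1)] by blast
      then show ?thesis using eq(2) SS colour_cell by metis
    next
      case False
      then show ?thesis using g SS by (auto simp: colourings_def PiE_iff extensional_def)
    qed
    then show "S = S' \<and> g = g'" using SS by blast
  qed
  show "(\<lambda>(S, g). (graph_of S, colour S g)) ` (SIGMA S:Pow rungs. colourings k (card S)) = configurations T k D"
  proof
    show "(\<lambda>(S, g). (graph_of S, colour S g)) ` (SIGMA S:Pow rungs. colourings k (card S)) \<subseteq> configurations T k D"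
      using graph_colour_config by auto
    show "configurations T k D \<subseteq> (\<lambda>(S, g). (graph_of S, colour S g)) ` (SIGMA S:Pow rungs. colourings k (card S))"
    proof
      fix \<gamma>c assume "\<gamma>c \<in> configurations T k D"
      then obtain S g where "S \<subseteq> rungs" "g \<in> colourings k (card S)" "\<gamma>c = (graph_of S, colour S g)"
        using config_graph_colour by (metis surj_pair)
      then show "\<gamma>c \<in> (\<lambda>(S, g). (graph_of S, colour S g)) ` (SIGMA S:Pow rungs. colourings k (card S))"
        by (intro image_eqI[of _ _ "(S, g)"]) auto
    qed
  qed
qed

section \<open>Partition function and independence of the rungs\<close>

lemma finite_rungs': "finite rungs"
  using finite_rungs_subset by blast

lemma finite_configurations: "finite (configurations T k D)"
proof -
  have "finite (SIGMA S:Pow rungs. colourings k (card S))"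
    by (intro finite_SigmaI finite_colourings) (simp add: finite_rungs')
  then show ?thesis using bij_betw_finite[OF bij_betw_configurations] by blast
qed

text \<open>The unnormalised Bernoulli weight: its total \<open>1 + \<pi> L\<close> is the
  denominator of the selection probability.\<close>

definition rung_weight :: "(plane set \<Rightarrow> real) \<Rightarrow> plane set \<Rightarrow> bool \<Rightarrow> real" where
  "rung_weight \<pi> L x = (if x then \<pi> L else 1)"

text \<open>Sets of truth values give these events the shape of product cylinders;
  \<open>B L = UNIV\<close> leaves the rung \<open>L\<close> unconstrained.\<close>

definition rung_event :: "nat \<Rightarrow> (plane set \<Rightarrow> bool set) \<Rightarrow> configuration set" where
  "rung_event k B = {\<gamma>c \<in> configurations T k D. \<forall>L\<in>rungs. (p L \<in> fst \<gamma>c) \<in> B L}"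

lemma prod_rung_weight:
  assumes "S \<subseteq> rungs"
  shows "(\<Prod>L\<in>rungs. rung_weight \<pi> L (L \<in> S)) = (\<Prod>L\<in>S. \<pi> L)"
proof -
  have "(\<Prod>L\<in>rungs. rung_weight \<pi> L (L \<in> S)) = (\<Prod>L\<in>rungs \<inter> S. \<pi> L)"
    by (simp add: rung_weight_def prod.inter_restrict finite_rungs')
  then show ?thesis using assms by (simp add: Int_absorb1)
qed

text \<open>The powers of \<open>k - 1\<close> from colour count and weight cancel, which leaves
  \<open>k\<close> times a sum over rung sets of products. As the constraints concern each rung
  separately, the sum factorises.\<close>

lemma sum_config_weight:
  assumes k: "k \<ge> 2" and \<pi>: "\<And>L. L \<in> T \<Longrightarrow> 0 < \<pi> L"
  shows "(\<Sum>\<gamma>c\<in>rung_event k B. config_weight T \<pi> k \<alpha> D \<gamma>c) =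
    ennreal (real k * (\<Prod>L\<in>rungs. \<Sum>x\<in>B L. rung_weight \<pi> L x))"
proof -
  define Q where "Q = {S \<in> Pow rungs. \<forall>L\<in>rungs. (L \<in> S) \<in> B L}"
  have Q: "S \<subseteq> rungs" if "S \<in> Q" for S using that by (simp add: Q_def)
  have finQ: "finite Q" by (simp add: Q_def finite_rungs')
  have pos: "0 \<le> (\<Prod>L\<in>S. \<pi> L)" if "S \<in> Q" for S
    using Q[OF that] rungsD(1) \<pi> by (intro prod_nonneg ballI less_imp_le) blast
  have bij: "bij_betw (\<lambda>(S, g). (graph_of S, colour S g)) (SIGMA S:Q. colourings k (card S)) (rung_event k B)"
  proof -
    have "bij_betw (\<lambda>(S, g). (graph_of S, colour S g))
        {x \<in> SIGMA S:Pow rungs. colourings k (card S). fst x \<in> Q} (rung_event k B)"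
      unfolding rung_event_def
      by (rule bij_betw_Collect[OF bij_betw_configurations]) (auto simp: Q_def p_mem_graph_iff)
    moreover have "{x \<in> SIGMA S:Pow rungs. colourings k (card S). fst x \<in> Q} = (SIGMA S:Q. colourings k (card S))"
      using Q by auto
    ultimately show ?thesis by simp
  qed
  have "(\<Sum>\<gamma>c\<in>rung_event k B. config_weight T \<pi> k \<alpha> D \<gamma>c) =
      (\<Sum>(S, g)\<in>(SIGMA S:Q. colourings k (card S)). config_weight T \<pi> k \<alpha> D (graph_of S, colour S g))"
    by (subst sum.reindex_bij_betw[OF bij, symmetric]) (simp add: case_prod_unfold)
  also have "\<dots> = (\<Sum>S\<in>Q. \<Sum>g\<in>colourings k (card S). config_weight T \<pi> k \<alpha> D (graph_of S, colour S g))"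
    by (rule sum.Sigma[symmetric]) (auto simp: finQ finite_colourings)
  also have "\<dots> = (\<Sum>S\<in>Q. ennreal (real k * (\<Prod>L\<in>S. \<pi> L)))"
  proof (rule sum.cong[OF refl])
    fix S assume S: "S \<in> Q"
    have "(\<Sum>g\<in>colourings k (card S). config_weight T \<pi> k \<alpha> D (graph_of S, colour S g)) =
        of_nat (card (colourings k (card S))) * ennreal ((\<Prod>L\<in>S. \<pi> L) / (real k - 1) ^ card S)"
      by (simp add: config_weight_eq[OF Q[OF S] k \<pi>])
    also have "\<dots> = ennreal (real (card (colourings k (card S))) * ((\<Prod>L\<in>S. \<pi> L) / (real k - 1) ^ card S))"
      unfolding ennreal_of_nat_eq_real_of_nat by (rule ennreal_mult'[symmetric]) simp
    also have "real (card (colourings k (card S))) = real k * (real k - 1) ^ card S"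
      using k by (simp add: card_colourings of_nat_diff)
    finally show "(\<Sum>g\<in>colourings k (card S). config_weight T \<pi> k \<alpha> D (graph_of S, colour S g)) =
        ennreal (real k * (\<Prod>L\<in>S. \<pi> L))"
      using k by simp
  qed
  also have "\<dots> = ennreal (\<Sum>S\<in>Q. real k * (\<Prod>L\<in>S. \<pi> L))"
    using pos by (intro sum_ennreal) auto
  also have "(\<Sum>S\<in>Q. real k * (\<Prod>L\<in>S. \<pi> L)) = real k * (\<Sum>S\<in>Q. \<Prod>L\<in>rungs. rung_weight \<pi> L (L \<in> S))"
    by (simp add: sum_distrib_left prod_rung_weight Q)
  \<comment> \<open>Subsets of \<open>rungs\<close> are identified with their indicator functions,
    so that the distributive law for \<open>PiE\<close> applies.\<close>
  also have "(\<Sum>S\<in>Q. \<Prod>L\<in>rungs. rung_weight \<pi> L (L \<in> S)) =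
      (\<Sum>h\<in>PiE rungs B. \<Prod>L\<in>rungs. rung_weight \<pi> L (h L))"
    by (rule sum.reindex_bij_witness[of _ "\<lambda>h. {L \<in> rungs. h L}" "\<lambda>S. \<lambda>L\<in>rungs. L \<in> S"])
      (auto simp: Q_def fun_eq_iff PiE_iff extensional_def intro!: prod.cong)
  also have "\<dots> = (\<Prod>L\<in>rungs. \<Sum>x\<in>B L. rung_weight \<pi> L x)"
    by (rule prod_sum_PiE[symmetric]) (auto simp: finite_rungs')
  finally show ?thesis .
qed

lemma emeasure_rung_event:
  assumes k: "k \<ge> 2" and \<pi>: "\<And>L. L \<in> T \<Longrightarrow> 0 < \<pi> L"
  shows "emeasure (consistent_field_law T \<pi> k \<alpha> D) (rung_event k B) =
    (\<Prod>L\<in>rungs. emeasure (measure_pmf (bernoulli_pmf (\<pi> L / (1 + \<pi> L)))) (B L))"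
proof -
  have pos: "0 < \<pi> L" if "L \<in> rungs" for L using \<pi> rungsD(1) that by blast
  let ?w = "\<lambda>B. \<Prod>L\<in>rungs. \<Sum>x\<in>B L. rung_weight \<pi> L x"
  have wnn: "0 \<le> (\<Sum>x\<in>X. rung_weight \<pi> L x)" if "L \<in> rungs" for L X
    using pos[OF that] by (intro sum_nonneg) (auto simp: rung_weight_def)
  have wU: "(\<Sum>x\<in>UNIV. rung_weight \<pi> L x) = 1 + \<pi> L" for L
    by (simp add: UNIV_bool rung_weight_def)
  have Upos: "0 < ?w (\<lambda>_. UNIV)" unfolding wU using pos by (intro prod_pos) (auto simp: add_pos_pos)
  have bern: "emeasure (measure_pmf (bernoulli_pmf (\<pi> L / (1 + \<pi> L)))) X =
      ennreal ((\<Sum>x\<in>X. rung_weight \<pi> L x) / (1 + \<pi> L))" if "L \<in> rungs" for L X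
  proof -
    have "pmf (bernoulli_pmf (\<pi> L / (1 + \<pi> L))) x = rung_weight \<pi> L x / (1 + \<pi> L)" for x
      using pos[OF that] by (cases x) (simp_all add: rung_weight_def field_simps)
    then show ?thesis by (simp add: emeasure_measure_pmf_finite sum_divide_distrib)
  qed
  \<comment> \<open>The partition function is the total weight of the unconstrained event. It equals
    \<open>k\<close> times the product of all \<open>1 + \<pi> L\<close>, and the factor
    \<open>k\<close> cancels in the quotient.\<close>
  have all: "configurations T k D = rung_event k (\<lambda>_. UNIV)" by (auto simp: rung_event_def)
  have "emeasure (consistent_field_law T \<pi> k \<alpha> D) (rung_event k B) =
      (\<Sum>\<gamma>c\<in>rung_event k B. config_weight T \<pi> k \<alpha> D \<gamma>c / (\<Sum>\<gamma>c'\<in>configurations T k D. config_weight T \<pi> k \<alpha> D \<gamma>c'))"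
    unfolding consistent_field_law_def
    by (rule emeasure_point_measure_finite[OF finite_configurations]) (auto simp: rung_event_def)
  also have "\<dots> = (\<Sum>\<gamma>c\<in>rung_event k B. config_weight T \<pi> k \<alpha> D \<gamma>c) /
      (\<Sum>\<gamma>c'\<in>configurations T k D. config_weight T \<pi> k \<alpha> D \<gamma>c')"
    by (simp add: divide_ennreal_def sum_distrib_right)
  also have "\<dots> = ennreal (real k * ?w B) / ennreal (real k * ?w (\<lambda>_. UNIV))"
    unfolding all by (simp only: sum_config_weight[where \<pi> = \<pi>, OF k \<pi>])
  also have "\<dots> = ennreal (real k * ?w B / (real k * ?w (\<lambda>_. UNIV)))"
    using k Upos wnn by (intro divide_ennreal mult_nonneg_nonneg mult_pos_pos prod_nonneg) auto
  also have "real k * ?w B / (real k * ?w (\<lambda>_. UNIV)) = (\<Prod>L\<in>rungs. (\<Sum>x\<in>B L. rung_weight \<pi> L x) / (1 + \<pi> L))"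
    using k by (simp add: wU prod_dividef)
  also have "ennreal \<dots> = (\<Prod>L\<in>rungs. ennreal ((\<Sum>x\<in>B L. rung_weight \<pi> L x) / (1 + \<pi> L)))"
    using wnn pos by (intro prod_ennreal[symmetric]) (auto intro!: divide_nonneg_pos simp: add_pos_pos)
  also have "\<dots> = (\<Prod>L\<in>rungs. emeasure (measure_pmf (bernoulli_pmf (\<pi> L / (1 + \<pi> L)))) (B L))"
    using bern by (intro prod.cong) auto
  finally show ?thesis .
qed

end

section \<open>Intersections with a line\<close>

lemma has_direction_subset: "has_direction L \<theta> \<Longrightarrow> e \<subseteq> L \<Longrightarrow> has_direction e \<theta>"
  unfolding has_direction_def by blast

text \<open>A one-point set has every direction, so two distinct points of \<open>e\<close> are
  needed to pass the direction on to its line.\<close>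

lemma has_direction_superset:
  assumes e: "has_direction e \<theta>" "x \<in> e" "y \<in> e" "x \<noteq> y"
    and L: "straight_line L" "x \<in> L" "y \<in> L"
  shows "has_direction L \<theta>"
proof -
  obtain c where c: "y - x = c *\<^sub>R vector [cos \<theta>, sin \<theta>]"
    using e by (auto simp: has_direction_def)
  have eq: "L = range (\<lambda>s. x + s *\<^sub>R (y - x))"
    using straight_line_eq_affine_hull[OF L e(4)] unfolding affine_hull_2_alt .
  have "\<exists>t. v - u = t *\<^sub>R vector [cos \<theta>, sin \<theta>]" if uv: "u \<in> L" "v \<in> L" for u v
  proof -
    obtain r s where "u = x + r *\<^sub>R (y - x)" "v = x + s *\<^sub>R (y - x)"
      using uv unfolding eq by blast
    then have "v - u = (s - r) *\<^sub>R (y - x)" by (simp add: scaleR_left_diff_distrib)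
    then have "v - u = ((s - r) * c) *\<^sub>R vector [cos \<theta>, sin \<theta>]" by (simp add: c)
    then show ?thesis by blast
  qed
  then show ?thesis using e(1) by (simp add: has_direction_def)
qed

lemma segment_UNIV_cases:
  assumes "s \<in> segments T UNIV"
  obtains L where "L \<in> T" "s \<in> components (L - nodes T)" "s \<subseteq> L" "s \<inter> nodes T = {}" "s \<noteq> {}"
proof -
  obtain L where L: "L \<in> T" "s \<in> components (L - nodes T)"
    using assms by (auto simp: segments_def)
  then show thesis using that in_components_subset[OF L(2)] in_components_nonempty[OF L(2)] by blast
qed

text \<open>A limit point of a segment that is not a node can be added without losing connectedness,
  so maximality of the component already contains it.\<close>

lemma mem_closure_segment:
  assumes T: "\<And>L. L \<in> T \<Longrightarrow> straight_line L"
    and s: "s \<in> segments T UNIV" and x: "x \<in> closure s" "x \<notin> nodes T" and L: "L \<in> T" "x \<in> L"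
  shows "x \<in> s" "s \<in> components (L - nodes T)"
proof -
  obtain L' where L': "L' \<in> T" "s \<in> components (L' - nodes T)" "s \<subseteq> L'" "s \<inter> nodes T = {}" "s \<noteq> {}"
    using segment_UNIV_cases[OF s] .
  have "closure s \<subseteq> L'"
    using L'(3) straight_line_closed[OF T[OF L'(1)]] by (rule closure_minimal)
  then have xL': "x \<in> L'" using x by blast
  then have "L' = L" using unique_line_through_non_node[OF L'(1) L(1) _ L(2) x(2)] by blast
  then show "s \<in> components (L - nodes T)" using L'(2) by simp
  have "connected (insert x s)"
    using in_components_connected[OF L'(2)] by (rule connected_intermediate_closure) (use x(1) closure_subset in auto)
  then have "insert x s \<subseteq> s"
    using components_maximal[OF L'(2), of "insert x s"] L'(3,4,5) xL' x(2) by blast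
  then show "x \<in> s" by blast
qed

text \<open>This expresses the observed pattern through the indicators of
  \<open>q L \<in> \<gamma>\<close> alone. It works because all of \<open>L \<inter> l\<close> lies
  in a single segment of \<open>L\<close>, which is in the graph or not as a whole.\<close>

lemma intersections_edges_UNIV:
  assumes T: "regular_tessellation T" and l: "straight_line l" "l \<inter> nodes T = {}"
    and q: "\<And>L. L \<in> T \<Longrightarrow> L \<inter> l \<noteq> {} \<Longrightarrow> q L \<in> L \<inter> l"
    and \<gamma>: "is_graph T UNIV \<gamma>"
  shows "intersections l (edges T UNIV \<gamma>) =
    {(x, \<theta>). \<exists>L\<in>T. q L \<in> \<gamma> \<and> x \<in> L \<inter> l \<and> has_direction L \<theta>}"
proof -
  have sl: "straight_line L" if "L \<in> T" for L using T that by (auto simp: regular_tessellation_def)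
  obtain S where S: "S \<subseteq> segments T UNIV" "\<gamma> = \<Union>(closure ` S)" using \<gamma> by (auto simp: is_graph_def)
  have conn: "connected (L \<inter> l)" if "L \<in> T" for L
    using convex_Int[OF straight_line_convex[OF sl[OF that]] straight_line_convex[OF l(1)]] convex_connected by blast
  have along: "L \<inter> l \<subseteq> s" if "s \<in> components (L - nodes T)" "x \<in> s" "x \<in> l" "L \<in> T" for s L x
  proof (rule components_maximal[OF that(1) conn[OF that(4)]])
    show "L \<inter> l \<subseteq> L - nodes T" using l(2) by blast
    show "s \<inter> (L \<inter> l) \<noteq> {}" using that in_components_subset[OF that(1)] by blast
  qed
  have in_line_part: "line_part T UNIV \<gamma> L \<subseteq> L" if "L \<in> T" for L
    unfolding line_part_def using straight_line_closed[OF sl[OF that]] closure_minimal by blast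
  show ?thesis
  proof (intro equalityI subsetI)
    fix z assume "z \<in> {(x, \<theta>). \<exists>L\<in>T. q L \<in> \<gamma> \<and> x \<in> L \<inter> l \<and> has_direction L \<theta>}"
    then obtain x \<theta> L where z: "z = (x, \<theta>)" and L: "L \<in> T" "q L \<in> \<gamma>" "x \<in> L" "x \<in> l" "has_direction L \<theta>"
      by auto
    have qL: "q L \<in> L" "q L \<in> l" "q L \<notin> nodes T" using q[OF L(1)] L l(2) by blast+
    obtain s where s: "s \<in> S" "q L \<in> closure s" using L(2) S(2) by blast
    have sseg: "s \<in> segments T UNIV" using s S by blast
    note s' = mem_closure_segment[OF sl sseg s(2) qL(3) L(1) qL(1)]
    have "x \<in> s" using along[OF s'(2,1) qL(2) L(1)] L by blast
    have ssub: "s \<subseteq> L" "s \<inter> nodes T = {}" using in_components_subset[OF s'(2)] by auto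
    have "s \<subseteq> \<gamma>" using s(1) S(2) closure_subset by blast
    then have "s \<in> {s \<in> graph_segments T UNIV \<gamma>. s \<subseteq> L}"
      using sseg ssub by (simp add: graph_segments_def)
    then have "s \<subseteq> line_part T UNIV \<gamma> L" unfolding line_part_def using closure_subset by blast
    \<comment> \<open>Interior vertices are nodes, and \<open>s\<close> contains none, so no vertex
      breaks \<open>s\<close> and it lies in one edge.\<close>
    then have sub: "s \<subseteq> line_part T UNIV \<gamma> L \<inter> UNIV - interior_vertices T UNIV \<gamma>"
      using ssub(2) by (auto simp: interior_vertices_def)
    then obtain e where e: "e \<in> components (line_part T UNIV \<gamma> L \<inter> UNIV - interior_vertices T UNIV \<gamma>)" "s \<subseteq> e"
      using exists_component_superset[OF sub _ in_components_connected[OF s'(2)]] \<open>x \<in> s\<close> by blast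
    have "e \<subseteq> L" using in_components_subset[OF e(1)] in_line_part[OF L(1)] by blast
    then have "has_direction e \<theta>" using has_direction_subset[OF L(5)] by blast
    moreover have "e \<in> edges T UNIV \<gamma>" unfolding edges_def using e(1) L(1) by blast
    ultimately show "z \<in> intersections l (edges T UNIV \<gamma>)"
      using z L(4) e(2) \<open>x \<in> s\<close> unfolding intersections_def by blast
  next
    fix z assume "z \<in> intersections l (edges T UNIV \<gamma>)"
    then obtain x \<theta> e where z: "z = (x, \<theta>)" and e: "e \<in> edges T UNIV \<gamma>" "x \<in> l" "x \<in> e" "has_direction e \<theta>"
      unfolding intersections_def by blast
    obtain L where L: "L \<in> T" "e \<in> components (line_part T UNIV \<gamma> L \<inter> UNIV - interior_vertices T UNIV \<gamma>)"
      using e(1) unfolding edges_def by blast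
    have xlp: "x \<in> line_part T UNIV \<gamma> L" using in_components_subset[OF L(2)] e(3) by blast
    then have xL: "x \<in> L" using in_line_part[OF L(1)] by blast
    have xn: "x \<notin> nodes T" using e(2) l(2) by blast
    obtain s where s: "s \<in> segments T UNIV" "s \<subseteq> \<gamma>" "s \<subseteq> L" "x \<in> closure s"
      using xlp unfolding line_part_def graph_segments_def by blast
    note s' = mem_closure_segment[OF sl s(1,4) xn L(1) xL]
    have "q L \<in> L \<inter> l" using q[OF L(1)] xL e(2) by blast
    then have "q L \<in> \<gamma>" using along[OF s'(2,1) e(2) L(1)] s(2) by blast
    have "s \<subseteq> line_part T UNIV \<gamma> L"
      using s closure_subset unfolding line_part_def graph_segments_def by blast
    then have "s \<subseteq> line_part T UNIV \<gamma> L \<inter> UNIV - interior_vertices T UNIV \<gamma>"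
      using in_components_subset[OF s'(2)] by (auto simp: interior_vertices_def)
    then have se: "s \<subseteq> e"
      using components_maximal[OF L(2) in_components_connected[OF s'(2)]] s'(1) e(3) by blast
    \<comment> \<open>Recovering the direction of \<open>L\<close> takes a second point of
      \<open>e\<close>. Near \<open>x\<close> there are no nodes, so a short piece of
      \<open>L\<close> around \<open>x\<close> belongs to \<open>s\<close> and hence to
      \<open>e\<close>.\<close>
    obtain D where D: "window T D" "{x} \<subseteq> D" "closure D \<inter> nodes T = {}"
      using exists_thin_window[OF T, of "{x}"] xn by force
    have oD: "open D" "convex D" using D(1) by (auto simp: window_def)
    have LD: "L \<inter> D \<subseteq> s"
    proof (rule components_maximal[OF s'(2)])
      show "connected (L \<inter> D)"
        using convex_Int[OF straight_line_convex[OF sl[OF L(1)]] oD(2)] convex_connected by blast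
      show "L \<inter> D \<subseteq> L - nodes T" using D(3) closure_subset by blast
      show "s \<inter> (L \<inter> D) \<noteq> {}" using s'(1) xL D(2) by blast
    qed
    obtain v where v: "v \<noteq> 0" "L = range (\<lambda>t. x + t *\<^sub>R v)"
      using straight_line_parametrization[OF sl[OF L(1)] xL] .
    obtain r where r: "r > 0" "ball x r \<subseteq> D" using oD(1) D(2) by (meson insert_subset openE)
    define y where "y = x + (r / (2 * norm v)) *\<^sub>R v"
    have "y \<in> L" using v(2) y_def by blast
    moreover have "y \<in> ball x r" using r(1) v(1) by (simp add: y_def dist_norm)
    ultimately have y: "y \<in> e" "y \<in> L" using r(2) LD se by blast+
    have "x \<noteq> y" using v(1) r(1) by (simp add: y_def)
    then have "has_direction L \<theta>" using has_direction_superset[OF e(4) e(3) y(1) _ sl[OF L(1)] xL y(2)] by blast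
    then show "z \<in> {(x, \<theta>). \<exists>L\<in>T. q L \<in> \<gamma> \<and> x \<in> L \<inter> l \<and> has_direction L \<theta>}"
      using z L(1) \<open>q L \<in> \<gamma>\<close> xL e(2) by blast
  qed
qed

section \<open>Measurability of the pattern\<close>

text \<open>By disjointness, the number of points in \<open>B\<close> is a countable sum of terms
  each depending on one coordinate.\<close>

lemma measurable_selected_Union:
  fixes P :: "'i \<Rightarrow> 'a::topological_space set"
  assumes I: "countable I" and P: "disjoint_family_on P I"
  shows "(\<lambda>x. \<Union>i\<in>{i \<in> I. x i}. P i) \<in> measurable (PiM I (\<lambda>i. measure_pmf (m i))) point_patterns"
  unfolding point_patterns_def
proof (rule measurable_measure_of)
  let ?N = "PiM I (\<lambda>i. measure_pmf (m i))"
  let ?F = "\<lambda>x. \<Union>i\<in>{i \<in> I. x i}. P i"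
  show "{{S :: 'a set. emeasure (count_space UNIV) (S \<inter> B) \<in> C} | B C. B \<in> sets borel \<and> C \<in> sets borel} \<subseteq> Pow UNIV"
    by simp
  fix Y :: "'a set set"
  assume "Y \<in> {{S. emeasure (count_space UNIV) (S \<inter> B) \<in> C} | B C. B \<in> sets borel \<and> C \<in> sets borel}"
  then obtain B C where Y: "Y = {S. emeasure (count_space UNIV) (S \<inter> B) \<in> C}" and C: "C \<in> sets borel"
    by blast
  let ?g = "\<lambda>x i. if x i then emeasure (count_space UNIV) (P i \<inter> B) else 0"
  have eq: "emeasure (count_space UNIV) (?F x \<inter> B) = (\<integral>\<^sup>+i. ?g x i \<partial>count_space I)" for x
  proof -
    have "?F x \<inter> B = (\<Union>i\<in>I. if x i then P i \<inter> B else {})" by auto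
    moreover have "emeasure (count_space UNIV) (\<Union>i\<in>I. if x i then P i \<inter> B else {}) =
        (\<integral>\<^sup>+i. emeasure (count_space UNIV) (if x i then P i \<inter> B else {}) \<partial>count_space I)"
      using P by (intro emeasure_UN_countable I) (auto simp: disjoint_family_on_def)
    ultimately show ?thesis by (simp add: if_distrib cong: if_cong)
  qed
  \<comment> \<open>The sum is treated as an integral over \<open>count_space I\<close>;
    countability gives \<sigma>-finiteness and reduces joint measurability to that of each
    summand.\<close>
  interpret sigma_finite_measure "count_space I" using I by (rule sigma_finite_measure_count_space_countable)
  have comp: "(\<lambda>x. ?g x i) \<in> borel_measurable ?N" if "i \<in> I" for i
    by (rule measurable_compose[OF measurable_component_singleton[OF that]]) simp
  have "(\<lambda>(i, x). ?g x i) \<in> borel_measurable (count_space I \<Otimes>\<^sub>M ?N)"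
    by (rule measurable_pair_measure_countable1[OF I]) (use comp in simp)
  from measurable_compose[OF measurable_pair_swap' this]
  have "(\<lambda>z. (\<lambda>(i, x). ?g x i) (case z of (x, i) \<Rightarrow> (i, x))) \<in> borel_measurable (?N \<Otimes>\<^sub>M count_space I)" .
  moreover have "(\<lambda>z. (\<lambda>(i, x). ?g x i) (case z of (x, i) \<Rightarrow> (i, x))) = (\<lambda>(x, i). ?g x i)"
    by (simp add: fun_eq_iff)
  ultimately have "(\<lambda>(x, i). ?g x i) \<in> borel_measurable (?N \<Otimes>\<^sub>M count_space I)" by simp
  then have meas: "(\<lambda>x. \<integral>\<^sup>+i. ?g x i \<partial>count_space I) \<in> borel_measurable ?N"
    by (rule borel_measurable_nn_integral)
  have "?F -` Y \<inter> space ?N = (\<lambda>x. \<integral>\<^sup>+i. ?g x i \<partial>count_space I) -` C \<inter> space ?N"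
    unfolding Y eq[symmetric] by auto
  then show "?F -` Y \<inter> space ?N \<in> sets ?N"
    using measurable_sets[OF meas C] by simp
qed simp

text \<open>
  The transversal is \<open>l\<close> itself unless \<open>l \<in> T\<close>. In that case \<open>l\<close> is the only line of \<open>T\<close> that meets
  \<open>l\<close>, and a normal of \<open>l\<close> serves as transversal.
\<close>

lemma transversal_direction:
  assumes T: "\<And>L. L \<in> T \<Longrightarrow> straight_line L" and l: "straight_line l" "l \<inter> nodes T = {}"
    and q: "\<And>L. L \<in> T \<Longrightarrow> L \<inter> l \<noteq> {} \<Longrightarrow> q L \<in> L \<inter> l"
  shows "\<exists>b v t. \<forall>L\<in>T. L \<inter> l \<noteq> {} \<longrightarrow> q L = b + t L *\<^sub>R v \<and> q L + v \<notin> L"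
proof (cases "l \<in> T")
  case True
  have only: "L = l" if "L \<in> T" "L \<inter> l \<noteq> {}" for L
    using that True l(2) unique_line_through_non_node[of L T l] by blast
  have "l \<noteq> {}" using l(1) by (auto simp: straight_line_def)
  then have ql: "q l \<in> l" using q[OF True] by blast
  obtain n where n: "n \<noteq> 0" "l = {x. n \<bullet> (x - q l) = 0}"
    using straight_line_normal[OF l(1) ql] .
  have "q l + n \<notin> l" using n(1) by (subst n(2)) simp
  then show ?thesis
    using only by (intro exI[of _ "q l"] exI[of _ n] exI[of _ "\<lambda>_. 0"]) auto
next
  case False
  have "l \<noteq> {}" using l(1) by (auto simp: straight_line_def)
  then obtain b where b: "b \<in> l" by blast
  obtain v where v: "v \<noteq> 0" "l = range (\<lambda>t. b + t *\<^sub>R v)"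
    using straight_line_parametrization[OF l(1) b] .
  have "\<exists>t. q L = b + t *\<^sub>R v \<and> q L + v \<notin> L" if L: "L \<in> T" "L \<inter> l \<noteq> {}" for L
  proof -
    have qL: "q L \<in> L" "q L \<in> l" using q[OF L] by auto
    obtain t where t: "q L = b + t *\<^sub>R v" using qL(2) v(2) by auto
    have "q L + v = b + (t + 1) *\<^sub>R v" by (simp add: t scaleR_left_distrib)
    then have "q L + v \<in> l" using v(2) by blast
    moreover have "q L \<noteq> q L + v" using v(1) by simp
    ultimately have "l = L" if "q L + v \<in> L"
      using straight_line_eq_affine_hull[OF T[OF L(1)] qL(1) that]
        straight_line_eq_affine_hull[OF l(1) qL(2), of "q L + v"] by blast
    then show ?thesis using t False L(1) by blast
  qed
  then show ?thesis by metis
qed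

section \<open>Finite marginals and the comparison of laws\<close>

lemma positive_normal:
  assumes "straight_line L" "p \<in> L" "p + v \<notin> L"
  shows "\<exists>n. n \<bullet> v > 0 \<and> L = {x. n \<bullet> (x - p) = 0}"
proof -
  obtain n where n: "n \<noteq> 0" "L = {x. n \<bullet> (x - p) = 0}"
    using straight_line_normal[OF assms(1,2)] .
  then have "n \<bullet> v \<noteq> 0" using assms(3) by auto
  then consider "n \<bullet> v > 0" | "(- n) \<bullet> v > 0" by (auto simp: neq_iff)
  then show ?thesis
  proof cases
    case 2
    moreover have "L = {x. (- n) \<bullet> (x - p) = 0}" using n(2) by simp
    ultimately show ?thesis by blast
  qed (use n(2) in blast)
qed

lemma line_Int_line_singleton:
  assumes "straight_line L" "straight_line l" "L \<noteq> l" "x \<in> L \<inter> l" "y \<in> L \<inter> l"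
  shows "x = y"
  using straight_line_eq_affine_hull[OF assms(1), of x y] straight_line_eq_affine_hull[OF assms(2), of x y] assms(3-5)
  by blast

text \<open>The points \<open>q L\<close> with \<open>L \<in> J\<close> span a compact convex piece
  of \<open>l\<close>; a thin window around it is a ladder, where the law is known. Other lines may
  cross this piece as well and are left unconstrained.\<close>

lemma whole_plane_field_marginal:
  assumes T: "regular_tessellation T"
    and \<pi>: "\<And>L. L \<in> T \<Longrightarrow> 0 < \<pi> L"
    and k: "k \<ge> 2"
    and A: "whole_plane_field T \<pi> k \<alpha> M A"
    and l: "straight_line l" "l \<inter> nodes T = {}"
    and q: "\<And>L. L \<in> T \<Longrightarrow> L \<inter> l \<noteq> {} \<Longrightarrow> q L \<in> L \<inter> l"
    and J: "finite J" "J \<noteq> {}" "J \<subseteq> {L \<in> T. L \<inter> l \<noteq> {}}"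
  shows "{\<omega> \<in> space M. \<forall>L\<in>J. (q L \<in> fst (A \<omega>)) \<in> B L} \<in> sets M"
    and "emeasure M {\<omega> \<in> space M. \<forall>L\<in>J. (q L \<in> fst (A \<omega>)) \<in> B L} =
      (\<Prod>L\<in>J. emeasure (measure_pmf (bernoulli_pmf (\<pi> L / (1 + \<pi> L)))) (B L))"
proof -
  have sl: "straight_line L" if "L \<in> T" for L using T that by (auto simp: regular_tessellation_def)
  define K where "K = convex hull (q ` J)"
  have Kl: "K \<subseteq> l"
    unfolding K_def using J(3) q straight_line_convex[OF l(1)] by (intro hull_minimal) auto
  have K: "compact K" "convex K" "K \<noteq> {}" "K \<inter> nodes T = {}"
    using J(1,2) Kl l(2) finite_imp_compact_convex_hull[of "q ` J"] by (auto simp: K_def)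
  \<comment> \<open>For \<open>L \<noteq> l\<close> the intersection with \<open>l\<close> is a
    single point. If \<open>L = l\<close>, a line of \<open>J\<close> different from
    \<open>l\<close> would produce a node on \<open>l\<close>, so \<open>J\<close> consists of
    \<open>l\<close> alone.\<close>
  have qK: "q L \<in> K" if L: "L \<in> T" "L \<inter> K \<noteq> {}" for L
  proof (cases "L = l")
    case True
    have "L' = l" if "L' \<in> J" for L'
      using that J(3) L(1) True l(2) unique_line_through_non_node[of L' T l] by blast
    then have "l \<in> J" using J(2) by blast
    then show ?thesis using True by (simp add: K_def hull_inc)
  next
    case False
    obtain x where x: "x \<in> L" "x \<in> K" using L(2) by blast
    then have "q L = x"
      using line_Int_line_singleton[OF sl[OF L(1)] l(1) False, of "q L" x] q[OF L(1)] Kl by blast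
    then show ?thesis using x(2) by simp
  qed
  obtain D where D: "window T D" "K \<subseteq> D" "closure D \<inter> nodes T = {}"
    "\<forall>L\<in>T. L \<inter> closure D \<noteq> {} \<longrightarrow> L \<inter> K \<noteq> {}"
    using exists_thin_window[OF T K] by (elim exE conjE) (rule that)
  have "\<exists>b v t. \<forall>L\<in>T. L \<inter> l \<noteq> {} \<longrightarrow> q L = b + t L *\<^sub>R v \<and> q L + v \<notin> L"
    by (rule transversal_direction[OF sl l q])
  then obtain b v t where "\<forall>L\<in>T. L \<inter> l \<noteq> {} \<longrightarrow> q L = b + t L *\<^sub>R v \<and> q L + v \<notin> L"
    by (elim exE) (rule that)
  then have bvt: "q L = b + t L *\<^sub>R v" "q L + v \<notin> L" if "L \<in> T" "L \<inter> l \<noteq> {}" for L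
    using that by blast+
  have "\<forall>L\<in>{L \<in> T. L \<inter> l \<noteq> {}}. \<exists>n. n \<bullet> v > 0 \<and> L = {x. n \<bullet> (x - q L) = 0}"
  proof
    fix L assume "L \<in> {L \<in> T. L \<inter> l \<noteq> {}}"
    then have L: "L \<in> T" "L \<inter> l \<noteq> {}" by simp_all
    have "q L \<in> L" using q[OF L] by simp
    from positive_normal[OF sl[OF L(1)] this bvt(2)[OF L]]
    show "\<exists>n. n \<bullet> v > 0 \<and> L = {x. n \<bullet> (x - q L) = 0}" .
  qed
  from bchoice[OF this] obtain n where nn:
    "\<forall>L\<in>{L \<in> T. L \<inter> l \<noteq> {}}. n L \<bullet> v > 0 \<and> L = {x. n L \<bullet> (x - q L) = 0}" by (elim exE) (rule that)
  have n: "n L \<bullet> v > 0 \<and> L = {x. n L \<bullet> (x - q L) = 0}" if "L \<in> T" "L \<inter> l \<noteq> {}" for L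
    by (rule bspec[OF nn]) (use that in simp)
  \<comment> \<open>Every line entering the window already meets \<open>K\<close>, hence
    \<open>l\<close>; so the transversal data are available for all rungs, not just those in
    \<open>J\<close>.\<close>
  have hit: "L \<inter> l \<noteq> {}" "q L \<in> D" if "L \<in> T" "L \<inter> D \<noteq> {}" for L
  proof -
    have "L \<inter> K \<noteq> {}" using that D(4) closure_subset by blast
    then show "L \<inter> l \<noteq> {}" "q L \<in> D" using Kl qK[OF that(1)] D(2) by blast+
  qed
  interpret ladder T D n b v t
  proof
    show "open D" "convex D" using D(1) by (auto simp: window_def)
    show "D \<noteq> {}" using D(2) K(3) by blast
    show "finite {L \<in> T. L \<inter> D \<noteq> {}}"
      using T D(1) by (auto simp: window_def regular_tessellation_def)
    show "L = {x. n L \<bullet> (x - (b + t L *\<^sub>R v)) = 0}" if "L \<in> T" "L \<inter> D \<noteq> {}" for L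
      using conjunct2[OF n[OF that(1) hit(1)[OF that]]] unfolding bvt(1)[OF that(1) hit(1)[OF that]] .
    show "b + t L *\<^sub>R v \<in> D" if "L \<in> T" "L \<inter> D \<noteq> {}" for L
      using hit(2)[OF that] unfolding bvt(1)[OF that(1) hit(1)[OF that]] .
    show "n L \<bullet> v > 0" if "L \<in> T" "L \<inter> D \<noteq> {}" for L
      using conjunct1[OF n[OF that(1) hit(1)[OF that]]] .
  qed (use D(3) sl in auto)
  have p: "p L = q L" if "L \<in> rungs" for L
    using bvt(1)[of L] hit(1)[of L] that unfolding p_def rungs_def by simp
  have JR: "J \<subseteq> rungs"
  proof
    fix L assume L: "L \<in> J"
    then have "q L \<in> K" by (simp add: K_def hull_inc)
    then have "q L \<in> L \<inter> D" using D(2) q[of L] J(3) L by blast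
    then show "L \<in> rungs" using L J(3) by (auto simp: rungs_def)
  qed
  define R where "R = (\<lambda>\<omega>. restrict_config D (A \<omega>))"
  define E where "E = rung_event k (\<lambda>L. if L \<in> J then B L else UNIV)"
  have R: "R \<in> measurable M (count_space (configurations T k D))"
    "distr M (count_space (configurations T k D)) R = consistent_field_law T \<pi> k \<alpha> D"
    using A D(1) unfolding whole_plane_field_def R_def by blast+
  have fstR: "q L \<in> fst (R \<omega>) \<longleftrightarrow> q L \<in> fst (A \<omega>)" if "L \<in> J" for L \<omega>
  proof -
    have "q L \<in> closure D" using rungsD(2)[of L] p[of L] JR that closure_subset by auto
    then show ?thesis by (simp add: R_def restrict_config_def case_prod_unfold)
  qed
  have eq: "{\<omega> \<in> space M. \<forall>L\<in>J. (q L \<in> fst (A \<omega>)) \<in> B L} = R -` E \<inter> space M"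
  proof -
    have "R \<omega> \<in> E \<longleftrightarrow> (\<forall>L\<in>J. (q L \<in> fst (A \<omega>)) \<in> B L)" if \<omega>: "\<omega> \<in> space M" for \<omega>
    proof -
      have "R \<omega> \<in> configurations T k D" using measurable_space[OF R(1) \<omega>] by simp
      then have "R \<omega> \<in> E \<longleftrightarrow> (\<forall>L\<in>rungs. L \<in> J \<longrightarrow> (p L \<in> fst (R \<omega>)) \<in> B L)"
        by (auto simp: E_def rung_event_def)
      also have "\<dots> \<longleftrightarrow> (\<forall>L\<in>J. (q L \<in> fst (A \<omega>)) \<in> B L)"
      proof -
        have "p L \<in> fst (R \<omega>) \<longleftrightarrow> q L \<in> fst (A \<omega>)" if "L \<in> J" for L
          using p[of L] fstR[OF that] JR that by auto
        then show ?thesis using JR by auto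
      qed
      finally show ?thesis .
    qed
    then show ?thesis by blast
  qed
  have E: "E \<in> sets (count_space (configurations T k D))" by (auto simp: E_def rung_event_def)
  show "{\<omega> \<in> space M. \<forall>L\<in>J. (q L \<in> fst (A \<omega>)) \<in> B L} \<in> sets M"
    unfolding eq using measurable_sets[OF R(1) E] .
  let ?m = "\<lambda>L. emeasure (measure_pmf (bernoulli_pmf (\<pi> L / (1 + \<pi> L))))"
  have "emeasure M (R -` E \<inter> space M) = emeasure (consistent_field_law T \<pi> k \<alpha> D) E"
    unfolding R(2)[symmetric] using emeasure_distr[OF R(1) E] by simp
  also have "\<dots> = (\<Prod>L\<in>rungs. ?m L (if L \<in> J then B L else UNIV))"
    unfolding E_def by (rule emeasure_rung_event[OF k \<pi>])
  also have "\<dots> = (\<Prod>L\<in>rungs. if L \<in> J then ?m L (B L) else 1)"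
    using measure_pmf.emeasure_space_1 by (intro prod.cong) auto
  also have "\<dots> = (\<Prod>L\<in>J. ?m L (B L))"
    using JR finite_rungs' by (simp add: prod.inter_restrict[symmetric] Int_absorb1)
  finally show "emeasure M {\<omega> \<in> space M. \<forall>L\<in>J. (q L \<in> fst (A \<omega>)) \<in> B L} = (\<Prod>L\<in>J. ?m L (B L))"
    unfolding eq .
qed

theorem corollary2:
  fixes T :: "plane set set" and \<pi> :: "plane set \<Rightarrow> real" and k :: nat and \<alpha>\<^sub>V :: real
    and M :: "'w measure" and A :: "'w \<Rightarrow> configuration" and l :: "plane set"
  assumes "regular_tessellation T"
    and "\<And>L. L \<in> T \<Longrightarrow> 0 < \<pi> L \<and> \<pi> L < 1"
    and "k \<ge> 2"
    and "0 \<le> \<alpha>\<^sub>V" and "\<alpha>\<^sub>V \<le> 1"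
    and "whole_plane_field T \<pi> k \<alpha>\<^sub>V M A"
    and "straight_line l"
    and "l \<inter> nodes T = {}"
  shows "(\<lambda>\<omega>. intersections l (edges T UNIV (fst (A \<omega>)))) \<in> measurable M point_patterns \<and>
    (\<lambda>\<omega>. intersections l (line_field T \<omega>)) \<in> measurable (line_flips T \<pi>) point_patterns \<and>
    distr M point_patterns (\<lambda>\<omega>. intersections l (edges T UNIV (fst (A \<omega>)))) =
    distr (line_flips T \<pi>) point_patterns (\<lambda>\<omega>. intersections l (line_field T \<omega>))"
proof -
  let ?m = "\<lambda>L. measure_pmf (bernoulli_pmf (\<pi> L / (1 + \<pi> L)))"
  define I where "I = {L \<in> T. L \<inter> l \<noteq> {}}"
  define q where "q L = (SOME x. x \<in> L \<inter> l)" for L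
  define P where "P L = {(x, \<theta>). x \<in> L \<inter> l \<and> has_direction L \<theta>}" for L
  define F where "F x = (\<Union>L\<in>{L \<in> I. x L}. P L)" for x
  \<comment> \<open>Both patterns are to be the image under the same \<open>F\<close> of a family of
    indicators indexed by \<open>I\<close>, so it suffices to compare the laws of the
    families.\<close>
  define X where "X \<omega> = (\<lambda>L\<in>I. q L \<in> fst (A \<omega>))" for \<omega>
  interpret M: prob_space M using assms(6) unfolding whole_plane_field_def by (rule conjunct1)
  interpret N: product_prob_space ?m I by standard
  have q: "q L \<in> L \<inter> l" if "L \<in> T" "L \<inter> l \<noteq> {}" for L
    unfolding q_def by (rule someI_ex) (use that in blast)
  have I: "I \<subseteq> T" "countable I"
    using assms(1) by (auto simp: I_def regular_tessellation_def)
  \<comment> \<open>A point common to two of these sets would be a node on \<open>l\<close>.\<close>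
  have "disjoint_family_on P I"
    unfolding disjoint_family_on_def P_def I_def
    using unique_line_through_non_node[of _ T] assms(8) by blast
  then have F: "F \<in> measurable (PiM I ?m) point_patterns"
    unfolding F_def[abs_def] using I(2) by (intro measurable_selected_Union)
  have marg: "{\<omega> \<in> space M. \<forall>L\<in>J. (q L \<in> fst (A \<omega>)) \<in> B L} \<in> sets M"
    "emeasure M {\<omega> \<in> space M. \<forall>L\<in>J. (q L \<in> fst (A \<omega>)) \<in> B L} = (\<Prod>L\<in>J. emeasure (?m L) (B L))"
    if "finite J" "J \<noteq> {}" "J \<subseteq> I" for J B
    using whole_plane_field_marginal[where q = q and J = J and B = B,
        OF assms(1) _ assms(3,6,7,8) q] assms(2) that unfolding I_def by auto
  have X: "X \<in> measurable M (PiM I ?m)"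
    unfolding X_def[abs_def]
  proof (rule measurable_restrict)
    fix L assume L: "L \<in> I"
    show "(\<lambda>\<omega>. q L \<in> fst (A \<omega>)) \<in> measurable M (?m L)"
    proof (rule measurableI)
      fix B :: "bool set"
      have "(\<lambda>\<omega>. q L \<in> fst (A \<omega>)) -` B \<inter> space M = {\<omega> \<in> space M. \<forall>L'\<in>{L}. (q L' \<in> fst (A \<omega>)) \<in> B}"
        by auto
      then show "(\<lambda>\<omega>. q L \<in> fst (A \<omega>)) -` B \<inter> space M \<in> sets M"
        using marg(1)[of "{L}" "\<lambda>_. B"] L by simp
    qed simp
  qed
  have dX: "distr M (PiM I ?m) X = PiM I ?m"
  proof (rule N.PiM_eq)
    fix J and B :: "plane set \<Rightarrow> bool set"
    assume J: "finite J" "J \<subseteq> I"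
    have emb: "prod_emb I ?m J (\<Pi>\<^sub>E L\<in>J. B L) \<in> sets (PiM I ?m)"
      using J by (intro sets_PiM_I) auto
    have eq: "X -` prod_emb I ?m J (\<Pi>\<^sub>E L\<in>J. B L) \<inter> space M = {\<omega> \<in> space M. \<forall>L\<in>J. (q L \<in> fst (A \<omega>)) \<in> B L}"
      using J(2) by (auto simp: prod_emb_def X_def PiE_iff subset_iff)
    show "emeasure (distr M (PiM I ?m) X) (prod_emb I ?m J (\<Pi>\<^sub>E L\<in>J. B L)) = (\<Prod>L\<in>J. emeasure (?m L) (B L))"
      unfolding emeasure_distr[OF X emb] eq
      \<comment> \<open>Empty \<open>J\<close> is separate because it spans no piece of
        \<open>l\<close>; then both sides are 1.\<close>
      using marg(2)[OF J(1) _ J(2), of B] M.emeasure_space_1 by (cases "J = {}") auto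
  qed simp
  \<comment> \<open>The coins are indexed by all of \<open>T\<close>; dropping those of lines that
    miss \<open>l\<close> leaves a product over \<open>I\<close>.\<close>
  have R: "(\<lambda>x. restrict x I) \<in> measurable (line_flips T \<pi>) (PiM I ?m)"
    unfolding line_flips_def by (rule measurable_restrict_subset[OF I(1)])
  have dR: "distr (line_flips T \<pi>) (PiM I ?m) (\<lambda>x. restrict x I) = PiM I ?m"
    unfolding line_flips_def
    by (rule distr_PiM_reindex[where f = "\<lambda>L. L"])
      (use I(1) in \<open>auto intro: measure_pmf.prob_space_axioms\<close>)
  have 1: "intersections l (edges T UNIV (fst (A \<omega>))) = F (X \<omega>)" if "\<omega> \<in> space M" for \<omega>
  proof -
    have "A \<omega> \<in> configurations T k UNIV" using assms(6) that unfolding whole_plane_field_def by blast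
    then have "is_graph T UNIV (fst (A \<omega>))"
      unfolding configurations_def case_prod_unfold mem_Collect_eq by (rule conjunct1)
    then show ?thesis
      using intersections_edges_UNIV[OF assms(1,7,8), of q] q
      by (auto simp: F_def X_def P_def I_def)
  qed
  have 2: "intersections l (line_field T x) = F (restrict x I)" for x
    unfolding intersections_def line_field_def F_def P_def I_def by auto
  have "(\<lambda>\<omega>. intersections l (edges T UNIV (fst (A \<omega>)))) \<in> measurable M point_patterns"
    using measurable_compose[OF X F] by (subst measurable_cong[OF 1])
  moreover have "(\<lambda>\<omega>. intersections l (line_field T \<omega>)) \<in> measurable (line_flips T \<pi>) point_patterns"
    unfolding 2 by (rule measurable_compose[OF R F])
  moreover have "distr M point_patterns (\<lambda>\<omega>. intersections l (edges T UNIV (fst (A \<omega>)))) =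
      distr M point_patterns (F \<circ> X)"
    using 1 by (intro distr_cong) auto
  moreover have "distr M point_patterns (F \<circ> X) = distr (PiM I ?m) point_patterns F"
    using distr_distr[OF F X] dX by simp
  moreover have "distr (line_flips T \<pi>) point_patterns (\<lambda>\<omega>. intersections l (line_field T \<omega>)) =
      distr (PiM I ?m) point_patterns F"
    using distr_distr[OF F R] dR unfolding 2 comp_def by simp
  ultimately show ?thesis by simp
qed

end
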